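(* For every prime $p\ge2$, the abelian cellular automata $F_p$ and $G_p$ over the alphabet $\mathcal A=\mathbb Z_p^2$ (with $\mathbb Z_p=\mathbb Z/p\mathbb Z$), defined for $c\in\mathcal A^{\mathbb Z}$ and $z\in\mathbb Z$ by $$F_p(c)_z=\bigl(\pi_1(c_{z+1})+\pi_2(c_z),\ \pi_1(c_z)\bigr),\qquad G_p(c)_z=\bigl(\pi_1(c_{z+1})+\pi_1(c_z)+\pi_2(c_z),\ \pi_1(c_z)\bigr),$$ strongly randomize the harmonically mixing measures: for every harmonically mixing probability measure $\mu$ on $\mathcal A^{\mathbb Z}$, $F_p^t\mu\to\lambda$ and $G_p^t\mu\to\lambda$ in the weak-$*$ topology as $t\to\infty$.
   Context: $\pi_1,\pi_2:\mathbb Z_p^2\to\mathbb Z_p$ are the two coordinate projections. For a Borel probability measure $\mu$ on $\mathcal A^{\mathbb Z}$ and $F$ continuous, $F\mu(U)=\mu(F^{-1}U)$. $\lambda$ is the uniform Bernoulli measure on $\mathcal A^{\mathbb Z}$ (i.i.d. cells uniform on $\mathcal A$). A character of $\mathcal A^{\mathbb Z}$ is a continuous group homomorphism $\chi$ to the unit circle, written uniquely $\chi(x)=\prod_{k\in\mathbb Z}\chi_k(x_k)$ with $\chi_k$ characters of $\mathcal A$, all but finitely many trivial; $\mathrm{rank}(\chi)=|\{k:\chi_k\ne\mathbf 1\}|$. $\mu$ is harmonically mixing if for all $\varepsilon>0$ there is $R>0$ such that $\mathrm{rank}(\chi)>R$ implies $\left|\int\chi\,d\mu\right|<\varepsilon$.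 *)

theory Defs
  imports
    "HOL-Probability.Probability"
    "HOL-Algebra.Product_Groups"
    "HOL-Algebra.Elementary_Groups"
begin

section \<open>Configurations over a finite group\<close>

definition config_group :: "'a monoid \<Rightarrow> (int \<Rightarrow> 'a) monoid" where
  "config_group A = product_group UNIV (\<lambda>_. A)"

definition config_topology :: "'a monoid \<Rightarrow> (int \<Rightarrow> 'a) topology" where
  "config_topology A = product_topology (\<lambda>_. discrete_topology (carrier A)) UNIV"

definition config_borel :: "'a monoid \<Rightarrow> (int \<Rightarrow> 'a) measure" where
  "config_borel A = sigma (topspace (config_topology A)) {U. openin (config_topology A) U}"

definition borel_probability :: "'a monoid \<Rightarrow> (int \<Rightarrow> 'a) measure \<Rightarrow> bool" where
  "borel_probability A \<mu> \<longleftrightarrow> prob_space \<mu> \<and> sets \<mu> = sets (config_borel A)"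

text \<open>The product sigma-algebra carried by this measure is the Borel one; see
  \<open>sets_uniform_bernoulli\<close> below.\<close>

definition uniform_bernoulli :: "'a monoid \<Rightarrow> (int \<Rightarrow> 'a) measure" where
  "uniform_bernoulli A = PiM UNIV (\<lambda>_. uniform_count_measure (carrier A))"

text \<open>The configuration space of a finite alphabet is compact, so every continuous test function
  is bounded.\<close>

definition weak_star_tendsto ::
  "'a monoid \<Rightarrow> (nat \<Rightarrow> (int \<Rightarrow> 'a) measure) \<Rightarrow> (int \<Rightarrow> 'a) measure \<Rightarrow> bool" where
  "weak_star_tendsto A M N \<longleftrightarrow>
     (\<forall>f :: (int \<Rightarrow> 'a) \<Rightarrow> real. continuous_map (config_topology A) euclideanreal f \<longrightarrow>
        (\<lambda>t. \<integral>x. f x \<partial>M t) \<longlonglongrightarrow> (\<integral>x. f x \<partial>N))"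


section \<open>Characters and harmonic mixing\<close>

definition circle_group :: "complex monoid" where
  "circle_group = \<lparr>carrier = sphere 0 1, monoid.mult = (*), one = 1\<rparr>"

definition config_character :: "'a monoid \<Rightarrow> ((int \<Rightarrow> 'a) \<Rightarrow> complex) \<Rightarrow> bool" where
  "config_character A \<xi> \<longleftrightarrow>
     \<xi> \<in> hom (config_group A) circle_group \<and>
     continuous_map (config_topology A) (top_of_set (sphere 0 1)) \<xi>"

definition nontrivial_cells :: "'a monoid \<Rightarrow> (int \<Rightarrow> 'a \<Rightarrow> complex) \<Rightarrow> int set" where
  "nontrivial_cells A X = {k. \<exists>a\<in>carrier A. X k a \<noteq> 1}"

definition character_factors ::
  "'a monoid \<Rightarrow> ((int \<Rightarrow> 'a) \<Rightarrow> complex) \<Rightarrow> (int \<Rightarrow> 'a \<Rightarrow> complex) \<Rightarrow> bool" where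
  "character_factors A \<xi> X \<longleftrightarrow>
     (\<forall>k. X k \<in> hom A circle_group) \<and>
     finite (nontrivial_cells A X) \<and>
     (\<forall>x\<in>carrier (config_group A). \<xi> x = (\<Prod>k\<in>nontrivial_cells A X. X k (x k)))"

text \<open>The factors are unique as functions on the carrier, hence so is the number described here;
  see \<open>config_character_factors\<close> and \<open>character_rank_eq\<close> below.\<close>

definition character_rank :: "'a monoid \<Rightarrow> ((int \<Rightarrow> 'a) \<Rightarrow> complex) \<Rightarrow> nat" where
  "character_rank A \<xi> = (THE r. \<exists>X. character_factors A \<xi> X \<and> r = card (nontrivial_cells A X))"

definition harmonically_mixing :: "'a monoid \<Rightarrow> (int \<Rightarrow> 'a) measure \<Rightarrow> bool" where
  "harmonically_mixing A \<mu> \<longleftrightarrow>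
     borel_probability A \<mu> \<and>
     (\<forall>\<epsilon>>0. \<exists>R>0. \<forall>\<xi>. config_character A \<xi> \<longrightarrow> real (character_rank A \<xi>) > R \<longrightarrow>
        cmod (\<integral>x. \<xi> x \<partial>\<mu>) < \<epsilon>)"

definition strongly_randomizes_harmonically_mixing ::
  "'a monoid \<Rightarrow> ((int \<Rightarrow> 'a) \<Rightarrow> (int \<Rightarrow> 'a)) \<Rightarrow> bool" where
  "strongly_randomizes_harmonically_mixing A \<Phi> \<longleftrightarrow>
     (\<forall>\<mu>. harmonically_mixing A \<mu> \<longrightarrow>
        weak_star_tendsto A (\<lambda>t. distr \<mu> (config_borel A) (\<Phi> ^^ t)) (uniform_bernoulli A))"


section \<open>The two cellular automata\<close>

definition Zp2 :: "nat \<Rightarrow> (int \<times> int) monoid" where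
  "Zp2 p = integer_mod_group p \<times>\<times> integer_mod_group p"

definition F_ca :: "nat \<Rightarrow> (int \<Rightarrow> int \<times> int) \<Rightarrow> (int \<Rightarrow> int \<times> int)" where
  "F_ca p c = (\<lambda>z. (fst (c (z + 1)) \<otimes>\<^bsub>integer_mod_group p\<^esub> snd (c z), fst (c z)))"

definition G_ca :: "nat \<Rightarrow> (int \<Rightarrow> int \<times> int) \<Rightarrow> (int \<Rightarrow> int \<times> int)" where
  "G_ca p c = (\<lambda>z. (fst (c (z + 1)) \<otimes>\<^bsub>integer_mod_group p\<^esub> fst (c z)
                      \<otimes>\<^bsub>integer_mod_group p\<^esub> snd (c z), fst (c z)))"

definition abelian_cellular_automaton ::
  "'a monoid \<Rightarrow> ((int \<Rightarrow> 'a) \<Rightarrow> (int \<Rightarrow> 'a)) \<Rightarrow> bool" where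
  "abelian_cellular_automaton A \<Phi> \<longleftrightarrow>
     comm_group A \<and> finite (carrier A) \<and>
     \<Phi> \<in> hom (config_group A) (config_group A) \<and>
     continuous_map (config_topology A) (config_topology A) \<Phi> \<and>
     (\<forall>x\<in>carrier (config_group A). \<Phi> (\<lambda>z. x (z + 1)) = (\<lambda>z. \<Phi> x (z + 1)))"


section \<open>The definitions are well posed\<close>

lemma carrier_config_group: "carrier (config_group A) = (\<Pi>\<^sub>E k\<in>UNIV. carrier A)"
  by (simp add: config_group_def product_group_def)

lemma topspace_config_topology: "topspace (config_topology A) = (\<Pi>\<^sub>E k\<in>UNIV. carrier A)"
  by (simp add: config_topology_def)

lemma mult_config_group: "x \<otimes>\<^bsub>config_group A\<^esub> y = (\<lambda>k. x k \<otimes>\<^bsub>A\<^esub> y k)"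
  by (simp add: config_group_def product_group_def restrict_UNIV)

lemma one_config_group: "\<one>\<^bsub>config_group A\<^esub> = (\<lambda>k. \<one>\<^bsub>A\<^esub>)"
  by (simp add: config_group_def product_group_def restrict_UNIV)

lemma group_config_group: "group A \<Longrightarrow> group (config_group A)"
  by (simp add: config_group_def product_group)

lemma group_circle_group: "group circle_group"
proof (rule groupI)
  fix x assume "x \<in> carrier circle_group"
  then have "cmod x = 1" "x \<noteq> 0" by (auto simp: circle_group_def)
  then show "\<exists>y\<in>carrier circle_group. y \<otimes>\<^bsub>circle_group\<^esub> x = \<one>\<^bsub>circle_group\<^esub>"
    by (intro bexI[of _ "inverse x"]) (auto simp: circle_group_def norm_inverse)
qed (auto simp: circle_group_def norm_mult)

lemma carrier_circle_group [simp]: "carrier circle_group = sphere 0 1"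
  and mult_circle_group [simp]: "x \<otimes>\<^bsub>circle_group\<^esub> y = x * y"
  and one_circle_group [simp]: "\<one>\<^bsub>circle_group\<^esub> = 1"
  by (simp_all add: circle_group_def)

definition single_cell :: "'a monoid \<Rightarrow> int \<Rightarrow> 'a \<Rightarrow> (int \<Rightarrow> 'a)" where
  "single_cell A k a = (\<lambda>_. \<one>\<^bsub>A\<^esub>)(k := a)"

lemma single_cell_in_carrier:
  "group A \<Longrightarrow> a \<in> carrier A \<Longrightarrow> single_cell A k a \<in> carrier (config_group A)"
  by (auto simp: carrier_config_group single_cell_def PiE_iff group.is_monoid monoid.one_closed)

lemma character_factors_single_cell:
  assumes A: "group A" and X: "character_factors A \<xi> X" and a: "a \<in> carrier A"
  shows "X k a = \<xi> (single_cell A k a)"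
proof -
  let ?S = "nontrivial_cells A X"
  have one: "X j \<one>\<^bsub>A\<^esub> = 1" for j
    using hom_one[of "X j" A circle_group] X A group_circle_group
    by (simp add: character_factors_def)
  have fin: "finite ?S" using X by (simp add: character_factors_def)
  have "\<xi> (single_cell A k a) = (\<Prod>j\<in>?S. X j (single_cell A k a j))"
    using X single_cell_in_carrier[OF A a] by (simp add: character_factors_def)
  also have "\<dots> = (\<Prod>j\<in>?S. if j = k then X k a else 1)"
    by (rule prod.cong) (auto simp: single_cell_def one)
  also have "\<dots> = (if k \<in> ?S then X k a else 1)"
    using fin by (simp add: prod.delta)
  also have "\<dots> = X k a"
    using a by (auto simp: nontrivial_cells_def)
  finally show ?thesis by simp
qed

lemma character_rank_eq:
  assumes A: "group A" and X: "character_factors A \<xi> X"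
  shows "character_rank A \<xi> = card (nontrivial_cells A X)"
proof -
  have eq: "nontrivial_cells A Y = nontrivial_cells A X" if "character_factors A \<xi> Y" for Y
    unfolding nontrivial_cells_def
    by (simp add: character_factors_single_cell[OF A that] character_factors_single_cell[OF A X]
        cong: bex_cong)
  show ?thesis
    unfolding character_rank_def
  proof (rule the_equality)
    show "\<exists>Y. character_factors A \<xi> Y \<and> card (nontrivial_cells A X) = card (nontrivial_cells A Y)"
      using X by blast
  qed (auto dest: eq)
qed

lemma circle_no_small_subgroup:
  fixes z :: complex
  assumes z: "cmod z = 1" and pos: "\<And>n. Re (z ^ n) > 0"
  shows "z = 1"
proof (rule ccontr)
  assume "z \<noteq> 1"
  have sq: "Re w ^ 2 + Im w ^ 2 = 1" if "cmod w = 1" for w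
    using that by (simp add: cmod_def)
  have "Re z \<noteq> 1"
    using sq[OF z] \<open>z \<noteq> 1\<close> by (auto simp: complex_eq_iff)
  moreover have "Re z \<le> 1" using complex_Re_le_cmod[of z] z by simp
  ultimately have r: "1 - Re z > 0" by simp
  have grow: "1 - Re (z ^ (2 ^ n)) \<ge> 2 ^ n * (1 - Re z)" for n
  proof (induction n)
    case (Suc n)
    define w where "w = z ^ (2 ^ n)"
    have w: "cmod w = 1" by (simp add: w_def norm_power z)
    have w0: "Re w > 0" using pos by (simp add: w_def)
    have w1: "Re w \<le> 1" using complex_Re_le_cmod[of w] w by simp
    have "Im w ^ 2 = 1 - Re w ^ 2" using sq[OF w] by simp
    moreover have "Re (w ^ 2) = Re w ^ 2 - Im w ^ 2" by (simp add: power2_eq_square)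
    ultimately have "1 - Re (w ^ 2) = 2 * (1 - Re w) * (1 + Re w)"
      by (simp add: algebra_simps power2_eq_square[of "Re w"])
    moreover have "2 * (1 - Re w) * 1 \<le> 2 * (1 - Re w) * (1 + Re w)"
      using w0 w1 by (intro mult_left_mono) auto
    ultimately have "1 - Re (w ^ 2) \<ge> 2 * (1 - Re w)" by simp
    moreover have "z ^ (2 ^ Suc n) = w ^ 2"
      unfolding w_def power_mult[symmetric] by (simp only: power_Suc2)
    ultimately show ?case using Suc.IH[folded w_def] by simp
  qed simp
  obtain n where "1 / (1 - Re z) < 2 ^ n"
    using real_arch_pow[of 2 "1 / (1 - Re z)"] by auto
  then have "1 < 2 ^ n * (1 - Re z)" using r by (simp add: field_simps)
  with grow[of n] pos[of "2 ^ n"] show False by simp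
qed

lemma config_character_factors:
  assumes A: "group A" and \<xi>: "config_character A \<xi>"
  shows "character_factors A \<xi> (\<lambda>k a. \<xi> (single_cell A k a))"
proof -
  let ?C = "carrier (config_group A)" and ?X = "\<lambda>k a. \<xi> (single_cell A k a)"
  interpret A: group A by (rule A)
  interpret C: group "config_group A" by (rule group_config_group[OF A])
  have hom: "\<xi> \<in> hom (config_group A) circle_group"
    and cont: "continuous_map (config_topology A) (top_of_set (sphere 0 1)) \<xi>"
    using \<xi> by (auto simp: config_character_def)
  have mult: "\<xi> (\<lambda>k. x k \<otimes>\<^bsub>A\<^esub> y k) = \<xi> x * \<xi> y" if "x \<in> ?C" "y \<in> ?C" for x y
    using hom_mult[OF hom that] by (simp add: mult_config_group)
  have one: "\<xi> (\<lambda>k. \<one>\<^bsub>A\<^esub>) = 1"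
    using hom_one[OF hom C.group_axioms group_circle_group] by (simp add: one_config_group)
  have norm: "cmod (\<xi> x) = 1" if "x \<in> ?C" for x
    using hom_in_carrier[OF hom that] by simp

  define U where "U = {x \<in> topspace (config_topology A). \<xi> x \<in> sphere 0 1 \<inter> {z. Re z > 0}}"
  have "openin (top_of_set (sphere 0 1)) (sphere 0 1 \<inter> {z. Re z > 0})"
    by (intro openin_open_Int open_halfspace_Re_gt)
  then have "openin (config_topology A) U"
    unfolding U_def by (rule openin_continuous_map_preimage[OF cont])
  moreover have "(\<lambda>k. \<one>\<^bsub>A\<^esub>) \<in> U"
    by (auto simp: U_def topspace_config_topology one PiE_iff)
  ultimately obtain V where V: "finite {i. V i \<noteq> carrier A}" "(\<lambda>k. \<one>\<^bsub>A\<^esub>) \<in> Pi\<^sub>E UNIV V" "Pi\<^sub>E UNIV V \<subseteq> U"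
    using product_topology_open_contains_basis[of "\<lambda>_. discrete_topology (carrier A)" UNIV U "\<lambda>k. \<one>\<^bsub>A\<^esub>"]
    unfolding config_topology_def topspace_discrete_topology by blast
  define J where "J = {i. V i \<noteq> carrier A}"
  have J: "finite J" using V by (simp add: J_def)

  have trivial: "\<xi> x = 1" if x: "x \<in> ?C" "\<And>k. k \<in> J \<Longrightarrow> x k = \<one>\<^bsub>A\<^esub>" for x
  proof (rule circle_no_small_subgroup[OF norm[OF x(1)]])
    fix n
    have pow: "(\<lambda>k. x k [^]\<^bsub>A\<^esub> n) \<in> ?C \<and> \<xi> (\<lambda>k. x k [^]\<^bsub>A\<^esub> n) = \<xi> x ^ n"
    proof (induction n)
      case 0
      show ?case by (simp add: one carrier_config_group PiE_iff)
    next
      case (Suc n)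
      then show ?case using x(1) mult[of "\<lambda>k. x k [^]\<^bsub>A\<^esub> n" x]
        by (auto simp: carrier_config_group PiE_iff)
    qed
    have "(\<lambda>k. x k [^]\<^bsub>A\<^esub> n) \<in> Pi\<^sub>E UNIV V"
    proof (rule PiE_I)
      fix k
      show "x k [^]\<^bsub>A\<^esub> n \<in> V k"
      proof (cases "k \<in> J")
        case True
        then show ?thesis using x(2) V(2) by (auto simp: PiE_iff)
      next
        case False
        then show ?thesis using pow by (auto simp: J_def carrier_config_group PiE_iff)
      qed
    qed simp
    then have "(\<lambda>k. x k [^]\<^bsub>A\<^esub> n) \<in> U" using V(3) by blast
    then show "Re (\<xi> x ^ n) > 0" using pow by (simp add: U_def)
  qed

  have restr: "(\<lambda>k. if k \<in> S then x k else \<one>\<^bsub>A\<^esub>) \<in> ?C" if "x \<in> ?C" for S x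
    using that by (auto simp: carrier_config_group PiE_iff)
  have fin_prod: "\<xi> (\<lambda>k. if k \<in> S then x k else \<one>\<^bsub>A\<^esub>) = (\<Prod>k\<in>S. ?X k (x k))"
    if "finite S" and x: "x \<in> ?C" for S x
    using that(1)
  proof (induction S)
    case empty
    show ?case by (simp add: one)
  next
    case (insert j S)
    have xj: "x i \<in> carrier A" for i using x by (auto simp: carrier_config_group PiE_iff)
    have "(\<lambda>k. if k \<in> insert j S then x k else \<one>\<^bsub>A\<^esub>)
        = (\<lambda>k. single_cell A j (x j) k \<otimes>\<^bsub>A\<^esub> (if k \<in> S then x k else \<one>\<^bsub>A\<^esub>))"
      using insert.hyps xj by (auto simp: single_cell_def fun_eq_iff)
    then have "\<xi> (\<lambda>k. if k \<in> insert j S then x k else \<one>\<^bsub>A\<^esub>)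
        = ?X j (x j) * \<xi> (\<lambda>k. if k \<in> S then x k else \<one>\<^bsub>A\<^esub>)"
      using mult[OF single_cell_in_carrier[OF A xj] restr[OF x]] by simp
    then show ?case using insert by simp
  qed

  have X_hom: "?X k \<in> hom A circle_group" for k
  proof (rule homI)
    fix a b assume ab: "a \<in> carrier A" "b \<in> carrier A"
    have "single_cell A k (a \<otimes>\<^bsub>A\<^esub> b) = (\<lambda>j. single_cell A k a j \<otimes>\<^bsub>A\<^esub> single_cell A k b j)"
      by (auto simp: single_cell_def fun_eq_iff)
    then show "?X k (a \<otimes>\<^bsub>A\<^esub> b) = ?X k a \<otimes>\<^bsub>circle_group\<^esub> ?X k b"
      using mult[OF single_cell_in_carrier[OF A ab(1)] single_cell_in_carrier[OF A ab(2)]] by simp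
  qed (use norm single_cell_in_carrier[OF A] in simp)

  have sub: "nontrivial_cells A ?X \<subseteq> J"
  proof
    fix k assume "k \<in> nontrivial_cells A ?X"
    then obtain a where a: "a \<in> carrier A" "?X k a \<noteq> 1" by (auto simp: nontrivial_cells_def)
    show "k \<in> J"
    proof (rule ccontr)
      assume "k \<notin> J"
      then have "?X k a = 1"
        by (intro trivial single_cell_in_carrier A a) (auto simp: single_cell_def)
      with a show False by simp
    qed
  qed

  have "\<xi> x = (\<Prod>k\<in>nontrivial_cells A ?X. ?X k (x k))" if x: "x \<in> ?C" for x
  proof -
    have xj: "x i \<in> carrier A" for i using x by (auto simp: carrier_config_group PiE_iff)
    have "x = (\<lambda>k. (if k \<in> J then x k else \<one>\<^bsub>A\<^esub>) \<otimes>\<^bsub>A\<^esub> (if k \<in> - J then x k else \<one>\<^bsub>A\<^esub>))"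
      using xj by (auto simp: fun_eq_iff)
    then have "\<xi> x = \<xi> (\<lambda>k. if k \<in> J then x k else \<one>\<^bsub>A\<^esub>) * \<xi> (\<lambda>k. if k \<in> - J then x k else \<one>\<^bsub>A\<^esub>)"
      using mult[OF restr[OF x, of J] restr[OF x, of "- J"]] by simp
    also have "\<xi> (\<lambda>k. if k \<in> - J then x k else \<one>\<^bsub>A\<^esub>) = 1"
      by (rule trivial[OF restr[OF x]]) simp
    also have "\<xi> (\<lambda>k. if k \<in> J then x k else \<one>\<^bsub>A\<^esub>) = (\<Prod>k\<in>J. ?X k (x k))"
      by (rule fin_prod[OF J x])
    also have "\<dots> = (\<Prod>k\<in>nontrivial_cells A ?X. ?X k (x k))"
      using xj by (intro prod.mono_neutral_right J sub) (auto simp: nontrivial_cells_def)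
    finally show ?thesis by simp
  qed
  then show ?thesis
    using X_hom finite_subset[OF sub J] by (simp add: character_factors_def)
qed

lemma sets_uniform_bernoulli:
  assumes "finite (carrier A)"
  shows "sets (uniform_bernoulli A) = sets (config_borel A)"
proof
  let ?C = "\<Pi>\<^sub>E k\<in>UNIV. carrier A" and ?M = "uniform_bernoulli A"
  have spM: "space ?M = ?C"
    by (simp add: uniform_bernoulli_def space_PiM space_uniform_count_measure)
  have spB: "space (config_borel A) = ?C"
    using openin_subset[of "config_topology A"]
    by (auto simp: config_borel_def topspace_config_topology space_measure_of_conv)
  have setsB: "sets (config_borel A) = sigma_sets ?C {U. openin (config_topology A) U}"
    using openin_subset[of "config_topology A"]
    by (auto simp: config_borel_def topspace_config_topology intro!: sets_measure_of)
  show "sets ?M \<subseteq> sets (config_borel A)"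
    unfolding uniform_bernoulli_def
  proof (rule sets_PiM_in_sets)
    fix k :: int and B assume "B \<in> sets (uniform_count_measure (carrier A))"
    then have "openin (discrete_topology (carrier A)) B"
      by (simp add: sets_uniform_count_measure)
    then have "openin (config_topology A) {x \<in> topspace (config_topology A). x k \<in> B}"
      unfolding config_topology_def
      by (rule openin_continuous_map_preimage[OF continuous_map_product_projection, rotated]) simp
    then show "{x \<in> space (config_borel A). x k \<in> B} \<in> sets (config_borel A)"
      by (simp add: setsB spB topspace_config_topology sigma_sets.Basic)
  qed (simp add: spB space_uniform_count_measure)
  have "U \<in> sets ?M" if U: "openin (config_topology A) U" for U
  proof -
    define cyl where "cyl n y = {x \<in> space ?M. \<forall>k\<in>{- int n..int n}. x k = y k}" for n y
    define Y where "Y n = {y \<in> (\<Pi>\<^sub>E k\<in>{- int n..int n}. carrier A). cyl n y \<subseteq> U}" for n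
    have cyl: "cyl n y \<in> sets ?M" if "y \<in> Y n" for n y
    proof -
      have "{x \<in> space ?M. x k = y k} \<in> sets ?M" if "k \<in> {- int n..int n}" for k
      proof -
        have "{y k} \<in> sets (uniform_count_measure (carrier A))"
          using \<open>y \<in> Y n\<close> that by (auto simp: Y_def sets_uniform_count_measure PiE_iff)
        moreover have "(\<lambda>x. x k) \<in> measurable ?M (uniform_count_measure (carrier A))"
          unfolding uniform_bernoulli_def by (rule measurable_component_singleton) simp
        ultimately have "(\<lambda>x. x k) -` {y k} \<inter> space ?M \<in> sets ?M" by (rule measurable_sets[rotated])
        also have "(\<lambda>x. x k) -` {y k} \<inter> space ?M = {x \<in> space ?M. x k = y k}" by auto
        finally show ?thesis .
      qed
      then show ?thesis unfolding cyl_def by (intro sets.sets_Collect_finite_All) auto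
    qed
    have finY: "finite (Y n)" for n
      unfolding Y_def by (rule finite_subset[of _ "\<Pi>\<^sub>E k\<in>{- int n..int n}. carrier A"])
        (auto intro!: finite_PiE assms)
    have "U \<subseteq> (\<Union>n. \<Union>y\<in>Y n. cyl n y)"
    proof
      fix x assume x: "x \<in> U"
      with openin_subset[OF U] have xC: "x \<in> ?C" by (auto simp: topspace_config_topology)
      obtain V where V: "x \<in> Pi\<^sub>E UNIV V" "finite {i. V i \<noteq> carrier A}" "Pi\<^sub>E UNIV V \<subseteq> U"
        using product_topology_open_contains_basis[OF U[unfolded config_topology_def] x] by auto
      define n where "n = nat (Max (insert 0 (abs ` {i. V i \<noteq> carrier A})))"
      have n: "k \<in> {- int n..int n}" if "V k \<noteq> carrier A" for k
      proof -
        have "\<bar>k\<bar> \<le> Max (insert 0 (abs ` {i. V i \<noteq> carrier A}))"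
          using V(2) that by (intro Max_ge) auto
        then show ?thesis by (auto simp: n_def)
      qed
      let ?y = "restrict x {- int n..int n}"
      have "cyl n ?y \<subseteq> Pi\<^sub>E UNIV V"
      proof
        fix z assume z: "z \<in> cyl n ?y"
        have "z k \<in> V k" for k
        proof (cases "V k = carrier A")
          case True
          then show ?thesis using z by (auto simp: cyl_def spM PiE_iff)
        next
          case False
          then have "z k = x k" using z n[OF False] by (auto simp: cyl_def)
          then show ?thesis using V(1) by (auto simp: PiE_iff)
        qed
        then show "z \<in> Pi\<^sub>E UNIV V" by auto
      qed
      then have "?y \<in> Y n" using V(3) xC by (auto simp: Y_def PiE_iff)
      moreover have "x \<in> cyl n ?y" using xC by (auto simp: cyl_def spM)
      ultimately show "x \<in> (\<Union>n. \<Union>y\<in>Y n. cyl n y)" by blast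
    qed
    then have "U = (\<Union>n. \<Union>y\<in>Y n. cyl n y)" by (auto simp: Y_def)
    moreover have "(\<Union>n. \<Union>y\<in>Y n. cyl n y) \<in> sets ?M"
      using finY cyl by (intro sets.countable_UN sets.finite_UN) auto
    ultimately show ?thesis by simp
  qed
  then show "sets (config_borel A) \<subseteq> sets ?M"
    unfolding setsB spM[symmetric] by (intro sets.sigma_sets_subset) auto
qed

lemma prob_space_uniform_bernoulli:
  assumes "group A" "finite (carrier A)"
  shows "prob_space (uniform_bernoulli A)"
proof -
  have "carrier A \<noteq> {}" using assms(1) by (metis empty_iff group.is_monoid monoid.one_closed)
  then show ?thesis unfolding uniform_bernoulli_def
    using assms by (intro prob_space_PiM prob_space_uniform_count_measure)
qed

lemma continuous_map_cell: "continuous_map (config_topology A) (discrete_topology (carrier A)) (\<lambda>c. c k)"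
  unfolding config_topology_def by (rule continuous_map_product_projection) simp

lemma continuous_map_local_rule:
  assumes cl: "\<And>a b. a \<in> carrier A \<Longrightarrow> b \<in> carrier A \<Longrightarrow> f a b \<in> carrier A"
  shows "continuous_map (config_topology A) (config_topology A) (\<lambda>c z. f (c (z + 1)) (c z))"
proof -
  let ?D = "discrete_topology (carrier A)"
  have "continuous_map (config_topology A) ?D (\<lambda>c. f (c (k + 1)) (c k))" for k
    unfolding continuous_map_def
  proof (intro conjI allI impI)
    show "(\<lambda>c. f (c (k + 1)) (c k)) \<in> topspace (config_topology A) \<rightarrow> topspace ?D"
      by (auto simp: topspace_config_topology PiE_iff cl)
    fix S assume "openin ?D S"
    have "openin (config_topology A) {c \<in> topspace (config_topology A). c j = a}"
      if "a \<in> carrier A" for j a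
      using openin_continuous_map_preimage[OF continuous_map_cell[of A j], of "{a}"] that by simp
    then have "openin (config_topology A)
        (\<Union>(a, b)\<in>{(a, b). a \<in> carrier A \<and> b \<in> carrier A \<and> f a b \<in> S}.
           {c \<in> topspace (config_topology A). c (k + 1) = a} \<inter>
           {c \<in> topspace (config_topology A). c k = b})"
      by (intro openin_Union) (auto intro!: openin_Int)
    also have "(\<Union>(a, b)\<in>{(a, b). a \<in> carrier A \<and> b \<in> carrier A \<and> f a b \<in> S}.
           {c \<in> topspace (config_topology A). c (k + 1) = a} \<inter>
           {c \<in> topspace (config_topology A). c k = b})
        = {c \<in> topspace (config_topology A). f (c (k + 1)) (c k) \<in> S}"
      by (auto simp: topspace_config_topology PiE_iff)
    finally show "openin (config_topology A)
        {c \<in> topspace (config_topology A). f (c (k + 1)) (c k) \<in> S}" .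
  qed
  then show ?thesis
    unfolding config_topology_def[of A] continuous_map_componentwise by auto
qed

lemma abelian_cellular_automaton_local_rule:
  assumes A: "comm_group A" "finite (carrier A)"
    and cl: "\<And>a b. a \<in> carrier A \<Longrightarrow> b \<in> carrier A \<Longrightarrow> f a b \<in> carrier A"
    and hom: "\<And>a b a' b'. a \<in> carrier A \<Longrightarrow> b \<in> carrier A \<Longrightarrow> a' \<in> carrier A \<Longrightarrow> b' \<in> carrier A \<Longrightarrow>
       f (a \<otimes>\<^bsub>A\<^esub> a') (b \<otimes>\<^bsub>A\<^esub> b') = f a b \<otimes>\<^bsub>A\<^esub> f a' b'"
  shows "abelian_cellular_automaton A (\<lambda>c z. f (c (z + 1)) (c z))"
  unfolding abelian_cellular_automaton_def
proof (intro conjI A)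
  show "(\<lambda>c z. f (c (z + 1)) (c z)) \<in> hom (config_group A) (config_group A)"
    by (rule homI) (auto simp: carrier_config_group mult_config_group PiE_iff cl hom)
  show "continuous_map (config_topology A) (config_topology A) (\<lambda>c z. f (c (z + 1)) (c z))"
    by (rule continuous_map_local_rule[of A f, OF cl])
qed simp

lemma abelian_cellular_automaton_F_G:
  assumes "p > 0"
  shows "abelian_cellular_automaton (Zp2 p) (F_ca p)"
    and "abelian_cellular_automaton (Zp2 p) (G_ca p)"
proof -
  have comm: "comm_group (Zp2 p)"
    unfolding Zp2_def
    by (intro group.group_comm_groupI DirProd_group group_integer_mod_group)
       (auto simp: integer_mod_group_def add.commute)
  have fin: "finite (carrier (Zp2 p))"
    using assms by (simp add: Zp2_def carrier_integer_mod_group)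
  let ?f = "\<lambda>a b. (fst a \<otimes>\<^bsub>integer_mod_group p\<^esub> snd b, fst b)"
  have "abelian_cellular_automaton (Zp2 p)
      (\<lambda>c z. (fst (c (z + 1)) \<otimes>\<^bsub>integer_mod_group p\<^esub> snd (c z), fst (c z)))"
  proof (rule abelian_cellular_automaton_local_rule[where f = ?f, OF comm fin])
    fix a b assume "a \<in> carrier (Zp2 p)" "b \<in> carrier (Zp2 p)"
    then show "?f a b \<in> carrier (Zp2 p)"
      using assms by (auto simp: Zp2_def integer_mod_group_def)
  next
    fix a b a' b'
    show "?f (a \<otimes>\<^bsub>Zp2 p\<^esub> a') (b \<otimes>\<^bsub>Zp2 p\<^esub> b') = ?f a b \<otimes>\<^bsub>Zp2 p\<^esub> ?f a' b'"
      by (simp add: Zp2_def mult_DirProd' integer_mod_group_def mod_simps)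
         (simp add: algebra_simps)
  qed
  then show "abelian_cellular_automaton (Zp2 p) (F_ca p)"
    by (simp add: F_ca_def[abs_def])
  let ?f = "\<lambda>a b. (fst a \<otimes>\<^bsub>integer_mod_group p\<^esub> fst b \<otimes>\<^bsub>integer_mod_group p\<^esub> snd b, fst b)"
  have "abelian_cellular_automaton (Zp2 p)
      (\<lambda>c z. (fst (c (z + 1)) \<otimes>\<^bsub>integer_mod_group p\<^esub> fst (c z)
               \<otimes>\<^bsub>integer_mod_group p\<^esub> snd (c z), fst (c z)))"
  proof (rule abelian_cellular_automaton_local_rule[where f = ?f, OF comm fin])
    fix a b assume "a \<in> carrier (Zp2 p)" "b \<in> carrier (Zp2 p)"
    then show "?f a b \<in> carrier (Zp2 p)"
      using assms by (auto simp: Zp2_def integer_mod_group_def)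
  next
    fix a b a' b'
    show "?f (a \<otimes>\<^bsub>Zp2 p\<^esub> a') (b \<otimes>\<^bsub>Zp2 p\<^esub> b') = ?f a b \<otimes>\<^bsub>Zp2 p\<^esub> ?f a' b'"
      by (simp add: Zp2_def mult_DirProd' integer_mod_group_def mod_simps)
         (simp add: algebra_simps)
  qed
  then show "abelian_cellular_automaton (Zp2 p) (G_ca p)"
    by (simp add: G_ca_def[abs_def])
qed

end

(* Integrating a character against the t-th image of mu amounts to integrating its image under the
   dual map. Writing a character as a pair (u, v) of Laurent polynomials over the field with p
   elements, the dual map is (u, v) |-> (q u + v, u) with q = x for F_p and q = x + 1 for G_p. Up to
   sign it preserves the form N(u, v) = v^2 + q u v - u^2, which is anisotropic because q has degree
   one. The degree of the t-th image of a nonzero pair grows linearly in t while its norm is fixed up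
   to sign. If the image had only R nonzero cells, its support would contain a cluster at the top, of
   length less than 2^R and separated from the rest by a gap longer than the cluster; the norm of
   that cluster is nonzero and would appear in N in high degree. So the rank of the image tends to
   infinity, harmonic mixing makes every nontrivial Fourier coefficient tend to 0, and Fourier
   inversion yields the convergence of cylinder probabilities. *)

theory Submission
  imports Defs "HOL-Computational_Algebra.Polynomial"
begin

section \<open>The dual map on pairs of polynomials\<close>

text \<open>This is the norm of \<open>v + u * \<alpha>\<close> in the quadratic extension by a root
  of \<open>\<alpha> * \<alpha> = q * \<alpha> + 1\<close>.\<close>

definition norm_form :: "'a::comm_ring_1 \<Rightarrow> 'a \<Rightarrow> 'a \<Rightarrow> 'a" where
  "norm_form q u v = v * v + q * u * v - u * u"

text \<open>In the coordinates \<open>(u, v)\<close> of \<open>v + u * \<alpha>\<close> this is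
  multiplication by \<alpha>. The norm of \<alpha> is -1, which accounts for the sign picked up at
  every step.\<close>

definition dual_step :: "'a::comm_ring_1 \<Rightarrow> 'a \<times> 'a \<Rightarrow> 'a \<times> 'a" where
  "dual_step q w = (q * fst w + snd w, fst w)"

text \<open>Polynomials over the field with \<open>p\<close> elements are represented by integer
  polynomials, with divisibility by \<open>p\<close> in place of vanishing.\<close>

definition pair_support :: "int \<Rightarrow> int poly \<times> int poly \<Rightarrow> nat set" where
  "pair_support p w = {i. \<not> (p dvd coeff (fst w) i \<and> p dvd coeff (snd w) i)}"

text \<open>Up to sign the two components can trade places, so a descent stated for a dominant
  \<open>u\<close> also serves a dominant \<open>v\<close>.\<close>

lemma norm_form_swap: "norm_form q v (- u) = - norm_form q u v"
  by (simp add: norm_form_def algebra_simps)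

lemma norm_form_dual_step: "norm_form q (q * u + v) u = - norm_form q u v"
  by (simp add: norm_form_def algebra_simps)

lemma norm_form_inverse_step: "norm_form q v (u - q * v) = - norm_form q u v"
  by (simp add: norm_form_def algebra_simps)

text \<open>The factor of \<open>m\<close> is the polar form of the norm. In use, \<open>m\<close>
  is the monomial that separates a cluster \<open>(f, g)\<close> from the lower part
  \<open>(a, b)\<close>.\<close>

lemma norm_form_shift:
  "norm_form q (a + m * f) (b + m * g) =
     norm_form q a b + m * (2 * b * g + q * (a * g + f * b) - 2 * a * f) + m * m * norm_form q f g"
  by (simp add: norm_form_def algebra_simps)

lemma norm_form_dual_step_funpow:
  "norm_form q (fst ((dual_step q ^^ t) w)) (snd ((dual_step q ^^ t) w)) = (-1) ^ t * norm_form q (fst w) (snd w)"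
  by (induction t) (simp_all add: dual_step_def norm_form_dual_step)

lemma norm_form_cong_dvd:
  fixes d :: "'a::comm_ring_1"
  assumes "d dvd u - u'" "d dvd v - v'"
  shows "d dvd norm_form q u v - norm_form q u' v'"
proof -
  have "norm_form q u v - norm_form q u' v' =
      (v - v') * (v + v' + q * u') + (u - u') * (q * v - u - u')"
    by (simp add: norm_form_def algebra_simps)
  then show ?thesis using assms by (simp add: dvd_mult2)
qed

section \<open>Anisotropy of the norm form modulo a prime\<close>

text \<open>In a representative with reduced coefficients, divisibility by \<open>p\<close> means
  being zero, so its integer degree is the degree modulo \<open>p\<close>.\<close>

lemma ex_reduced_poly:
  fixes f :: "int poly"
  shows "\<exists>g. (\<forall>i. coeff g i = coeff f i mod p) \<and> [:p:] dvd f - g"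
proof (intro exI conjI allI)
  let ?g = "map_poly (\<lambda>a. a mod p) f"
  show "coeff ?g i = coeff f i mod p" for i
    by (simp add: coeff_map_poly)
  then show "[:p:] dvd f - ?g"
    by (simp add: const_poly_dvd_iff)
qed

text \<open>Comparing leading coefficients forces \<open>degree v = degree u - 1\<close> with equal leading coefficients
  modulo \<open>p\<close>, so that the inverse step \<open>(u, v) \<mapsto> (v, u - q v)\<close> lowers the degree.\<close>

lemma norm_form_descent:
  fixes u v :: "int poly"
  assumes p: "prime p" and dvd: "[:p:] dvd norm_form [:c, 1:] u v"
    and v_red: "\<And>i. p dvd coeff v i \<Longrightarrow> coeff v i = 0"
    and u: "degree u = n" "\<not> p dvd lead_coeff u" and v: "degree v \<le> n"
    and IH: "\<And>u v. \<lbrakk>[:p:] dvd norm_form [:c, 1:] u v; \<forall>i\<ge>n. p dvd coeff u i \<and> p dvd coeff v i\<rbrakk>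
      \<Longrightarrow> [:p:] dvd u \<and> [:p:] dvd v"
  shows "[:p:] dvd u \<and> [:p:] dvd v"
proof -
  define q where "q = [:c, 1:]"
  have pN: "p dvd coeff (v * v) i + coeff (q * u * v) i - coeff (u * u) i" for i
    using dvd by (simp only: norm_form_def q_def const_poly_dvd_iff coeff_add coeff_diff)
  have u0: "u \<noteq> 0" using u by auto
  have uu: "coeff (u * u) (2 * n) = lead_coeff u * lead_coeff u"
    using coeff_mult_degree_sum[of u u] u by (simp add: mult_2)
  \<comment> \<open>Otherwise \<open>u * u\<close> would be the only contribution in degree
    \<open>2 * n\<close>, and its coefficient there is a square prime to \<open>p\<close>.\<close>
  have low: "\<not> (\<forall>i\<ge>2*n. coeff (v * v) i = 0 \<and> coeff (q * u * v) i = 0)"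
  proof
    assume "\<forall>i\<ge>2*n. coeff (v * v) i = 0 \<and> coeff (q * u * v) i = 0"
    then have "p dvd lead_coeff u * lead_coeff u" using pN[of "2 * n"] uu by auto
    then show False using p u by (simp add: prime_dvd_mult_iff)
  qed
  have v0: "v \<noteq> 0" using low by auto
  have lv: "\<not> p dvd lead_coeff v" using v_red[of "degree v"] v0 by auto
  have q0: "q \<noteq> 0" "degree q = 1" "lead_coeff q = 1" by (auto simp: q_def)
  have deg: "degree (q * u * v) = Suc (n + degree v)"
    by (simp only: degree_mult_eq q0 u0 v0 u mult_eq_0_iff not_False_eq_True simp_thms)
  have lead: "coeff (q * u * v) (Suc (n + degree v)) = lead_coeff u * lead_coeff v"
    unfolding deg[symmetric] lead_coeff_mult using q0 by simp
  have vv: "coeff (v * v) i = 0" if "i > 2 * degree v" for i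
    using that by (intro coeff_eq_0) (simp add: degree_mult_eq v0)
  \<comment> \<open>For equal degrees, \<open>q * u * v\<close> alone reaches degree
    \<open>2 * n + 1\<close>, because \<open>q\<close> is monic of degree one.\<close>
  have "degree v \<noteq> n"
  proof
    assume dv: "degree v = n"
    have "coeff (u * u) (Suc (n + degree v)) = 0"
      using u dv by (intro coeff_eq_0) (simp add: degree_mult_eq u0)
    then have "p dvd lead_coeff u * lead_coeff v"
      using pN[of "Suc (n + degree v)"] lead vv[of "Suc (n + degree v)"] dv by auto
    then show False using p u lv by (simp add: prime_dvd_mult_iff)
  qed
  moreover have "\<not> degree v + 1 < n"
  proof
    assume "degree v + 1 < n"
    then have "\<forall>i\<ge>2*n. coeff (v * v) i = 0 \<and> coeff (q * u * v) i = 0"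
      using vv deg by (auto intro!: coeff_eq_0)
    then show False using low by blast
  qed
  ultimately have dv: "n = Suc (degree v)" using v by linarith
  \<comment> \<open>In degree \<open>2 * n\<close> only \<open>q * u * v\<close> and
    \<open>u * u\<close> remain, since \<open>v * v\<close> stops at
    \<open>2 * n - 2\<close>.\<close>
  have "p dvd lead_coeff u * (lead_coeff v - lead_coeff u)"
  proof -
    have "2 * n = Suc (n + degree v)" using dv by simp
    then show ?thesis
      using pN[of "2 * n"] uu lead vv[of "2 * n"] dv
      by (simp only: right_diff_distrib) simp
  qed
  then have pl: "p dvd lead_coeff v - lead_coeff u"
    using p u by (simp add: prime_dvd_mult_iff)
  \<comment> \<open>The pair \<open>(v, u - q * v)\<close> vanishes modulo \<open>p\<close> from
    degree \<open>n\<close> on: in degree \<open>n\<close> itself, the equal leading coefficients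
    cancel. This is what \<open>IH\<close> asks for.\<close>
  have "\<forall>i\<ge>n. p dvd coeff v i \<and> p dvd coeff (u - q * v) i"
  proof (intro allI impI)
    fix i assume i: "n \<le> i"
    then have "coeff v i = 0" using dv by (intro coeff_eq_0) simp
    moreover have "p dvd coeff (u - q * v) i"
    proof (cases "i = n")
      case True
      then show ?thesis using \<open>coeff v i = 0\<close> pl dv u by (simp add: q_def dvd_diff_commute)
    next
      case False
      then have "coeff u i = 0" "coeff v i = 0" "coeff v (i - 1) = 0"
        using i dv u by (auto intro!: coeff_eq_0)
      then show ?thesis using i dv by (cases i) (simp_all add: q_def)
    qed
    ultimately show "p dvd coeff v i \<and> p dvd coeff (u - q * v) i" by simp
  qed
  moreover have "[:p:] dvd norm_form q v (u - q * v)"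
    using dvd by (simp only: q_def norm_form_inverse_step dvd_minus_iff)
  ultimately have "[:p:] dvd v" "[:p:] dvd u - q * v" using IH unfolding q_def by blast+
  then show ?thesis
    by (metis dvd_add dvd_mult diff_add_cancel)
qed

text \<open>Induction on a bound \<open>n\<close> for the degrees modulo \<open>p\<close>. When
  either component attains the top degree, the inverse step gives a pair of smaller degree with the
  same norm up to sign; the only pair left at the end is zero.\<close>

lemma norm_form_anisotropic:
  fixes u v :: "int poly"
  assumes p: "prime p" and dvd: "[:p:] dvd norm_form [:c, 1:] u v"
  shows "[:p:] dvd u \<and> [:p:] dvd v"
proof -
  have main: "[:p:] dvd u \<and> [:p:] dvd v"
    if "[:p:] dvd norm_form [:c, 1:] u v" "\<forall>i\<ge>n. p dvd coeff u i \<and> p dvd coeff v i" for n u v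
    using that
  proof (induction n arbitrary: u v)
    case 0
    from "0.prems"(2) show ?case by (simp only: const_poly_dvd_iff) blast
  next
    case (Suc n)
    obtain u' where u': "\<And>i. coeff u' i = coeff u i mod p" "[:p:] dvd u - u'"
      using ex_reduced_poly[of u p] by blast
    obtain v' where v': "\<And>i. coeff v' i = coeff v i mod p" "[:p:] dvd v - v'"
      using ex_reduced_poly[of v p] by blast
    have N: "[:p:] dvd norm_form [:c, 1:] u' v'"
      using dvd_diff[OF Suc.prems(1) norm_form_cong_dvd[OF u'(2) v'(2), of "[:c, 1:]"]]
      by (simp only: diff_diff_eq2 add_diff_cancel_left')
    have degs: "degree u' \<le> n" "degree v' \<le> n"
      using Suc.prems(2) u'(1) v'(1) by (auto intro!: degree_le simp only: Suc_le_eq dvd_eq_mod_eq_0)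
    have red: "p dvd coeff u' i \<Longrightarrow> coeff u' i = 0" "p dvd coeff v' i \<Longrightarrow> coeff v' i = 0" for i
      by (auto simp: u'(1) v'(1) dvd_eq_mod_eq_0)
    have "[:p:] dvd u' \<and> [:p:] dvd v'"
    proof (cases "coeff u' n = 0")
      case False
      then have "degree u' = n" using degs by (intro antisym le_degree)
      moreover have "\<not> p dvd lead_coeff u'" using red False \<open>degree u' = n\<close> by auto
      ultimately show ?thesis
        by (intro norm_form_descent[OF p N red(2) _ _ degs(2) Suc.IH]) simp_all
    next
      case u0: True
      show ?thesis
      proof (cases "coeff v' n = 0")
        case False
        then have "degree v' = n" using degs by (intro antisym le_degree)
        moreover have "\<not> p dvd lead_coeff v'" using red False \<open>degree v' = n\<close> by auto
        \<comment> \<open>Here \<open>v'\<close> has the top degree, so the descent is run on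
          \<open>(v', - u')\<close>.\<close>
        moreover have "[:p:] dvd norm_form [:c, 1:] v' (- u')"
          unfolding norm_form_swap using N by (simp only: dvd_minus_iff)
        moreover have "coeff (- u') i = 0" if "p dvd coeff (- u') i" for i
          using that red(1) by simp
        moreover have "degree (- u') \<le> n" using degs by simp
        ultimately have "[:p:] dvd v' \<and> [:p:] dvd - u'"
          by (intro norm_form_descent[where n = n and c = c, OF p _ _ _ _ _ Suc.IH]) blast+
        then show ?thesis by simp
      next
        case True
        then have "\<forall>i\<ge>n. p dvd coeff u' i \<and> p dvd coeff v' i"
        proof (intro allI impI)
          fix i assume "n \<le> i"
          then have "i = n \<or> degree u' < i \<and> degree v' < i" using degs by linarith
          then show "p dvd coeff u' i \<and> p dvd coeff v' i" using u0 True by (auto simp: coeff_eq_0)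
        qed
        with N show ?thesis by (rule Suc.IH)
      qed
    qed
    then show ?case using u'(2) v'(2) using dvd_diff_left_iff by metis
  qed
  have "\<forall>i\<ge>Suc (max (degree u) (degree v)). p dvd coeff u i \<and> p dvd coeff v i"
    by (auto simp: coeff_eq_0)
  then show ?thesis using main dvd by blast
qed

section \<open>Sparse supports and their top cluster\<close>

lemma top_cluster:
  fixes S :: "nat set"
  assumes "finite S" "S \<noteq> {}"
  obtains k where "k \<in> S" "Max S < k + 2 ^ card S" "\<And>i. i \<in> S \<Longrightarrow> i < k \<Longrightarrow> i + Max S + 2 \<le> 2 * k"
proof -
  let ?m = "Max S" and ?up = "\<lambda>k. {i \<in> S. k \<le> i}"
  \<comment> \<open>\<open>Q k\<close> bounds the part of \<open>S\<close> from \<open>k\<close>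
    upwards in terms of its own cardinality; the least such \<open>k\<close> is the bottom of the
    cluster.\<close>
  define Q where "Q k \<longleftrightarrow> k \<in> S \<and> ?m < k + 2 ^ card (?up k)" for k
  have "Q ?m" using assms by (simp add: Q_def)
  define k where "k = (LEAST k. Q k)"
  have k: "Q k" unfolding k_def by (rule LeastI) fact
  have least: "\<not> Q j" if "j < k" for j using that not_less_Least k_def by blast
  have "k \<in> S" using k Q_def by blast
  moreover have "?m < k + 2 ^ card S"
  proof -
    have "(2::nat) ^ card (?up k) \<le> 2 ^ card S"
      using assms by (intro power_increasing card_mono) auto
    moreover have "?m < k + 2 ^ card (?up k)" using k Q_def by blast
    ultimately show ?thesis by linarith
  qed
  moreover have "i + ?m + 2 \<le> 2 * k" if i: "i \<in> S" "i < k" for i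
  proof -
    \<comment> \<open>The predecessor of \<open>k\<close> in \<open>S\<close>: passing to it adds
      exactly one element to the upper part, and by minimality of \<open>k\<close> it fails
      \<open>Q\<close>.\<close>
    define j where "j = Max {i \<in> S. i < k}"
    have "j \<in> {i \<in> S. i < k}" unfolding j_def using assms i by (intro Max_in) auto
    then have j: "j \<in> S" "j < k" by auto
    have ij: "i \<le> j" unfolding j_def using assms i by (intro Max_ge) auto
    have "?up j = insert j (?up k)"
    proof -
      have "i' \<le> j" if "i' \<in> S" "i' < k" for i'
        unfolding j_def using assms that by (intro Max_ge) auto
      then show ?thesis using j by force
    qed
    then have "card (?up j) = Suc (card (?up k))" using j assms by simp
    then have "j + 2 * 2 ^ card (?up k) \<le> ?m" using least[OF j(2)] j by (simp add: Q_def)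
    then show ?thesis using k ij by (simp add: Q_def)
  qed
  ultimately show thesis using that by blast
qed

lemma finite_pair_support: "finite (pair_support p w)"
proof (rule finite_subset)
  show "pair_support p w \<subseteq> {..max (degree (fst w)) (degree (snd w))}"
    by (auto simp: pair_support_def le_degree intro: ccontr) (metis coeff_eq_0 dvd_0_right le_max_iff_disj not_le)+
qed simp

text \<open>Split \<open>(u, v)\<close> at the bottom \<open>k\<close> of the top cluster. By the gap below \<open>k\<close>, products involving the
  lower part have degree less than \<open>2 k\<close>, so from degree \<open>2 k\<close> on only the norm of the cluster is seen.\<close>

lemma pair_support_bound:
  fixes u v :: "int poly"
  assumes p: "prime p" and ne: "pair_support p (u, v) \<noteq> {}"
    and D: "\<And>i. D \<le> i \<Longrightarrow> p dvd coeff (norm_form [:c, 1:] u v) i"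
  shows "Max (pair_support p (u, v)) < D + 2 ^ card (pair_support p (u, v))"
proof -
  let ?S = "pair_support p (u, v)" and ?q = "[:c, 1:] :: int poly"
  define m where "m = Max ?S"
  obtain u' where u': "\<And>i. coeff u' i = coeff u i mod p" "[:p:] dvd u - u'"
    using ex_reduced_poly[of u p] by blast
  obtain v' where v': "\<And>i. coeff v' i = coeff v i mod p" "[:p:] dvd v - v'"
    using ex_reduced_poly[of v p] by blast
  have supp: "i \<in> ?S \<longleftrightarrow> \<not> (coeff u' i = 0 \<and> coeff v' i = 0)" for i
    by (simp add: pair_support_def u' v' dvd_eq_mod_eq_0)
  have m: "coeff u' i = 0 \<and> coeff v' i = 0" if "i > m" for i
    using that supp Max_ge[OF finite_pair_support] unfolding m_def by (meson not_le)
  obtain k where k: "k \<in> ?S" "m < k + 2 ^ card ?S" "\<And>i. i \<in> ?S \<Longrightarrow> i < k \<Longrightarrow> i + m + 2 \<le> 2 * k"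
    unfolding m_def using top_cluster[OF finite_pair_support ne] by metis
  have km: "k \<le> m" unfolding m_def using k(1) finite_pair_support by simp
  \<comment> \<open>\<open>(a, b)\<close> is the part below \<open>k\<close>, and
    \<open>(f, g)\<close> is the cluster moved down to start at degree 0.\<close>
  define a b f g where "a = poly_cutoff k u'" "b = poly_cutoff k v'" "f = poly_shift k u'" "g = poly_shift k v'"
  note defs = this
  have split: "u' = a + monom 1 k * f" "v' = b + monom 1 k * g"
    by (auto simp: defs poly_eq_iff coeff_monom_mult coeff_poly_cutoff coeff_poly_shift)
  define T where "T = 2 * b * g + ?q * (a * g + f * b) - 2 * a * f"
  have "norm_form ?q u' v' = norm_form ?q a b + monom 1 k * T + monom 1 (2 * k) * norm_form ?q f g"
    unfolding split norm_form_shift T_def by (simp add: mult_monom mult_2[of k] mult.assoc)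
  moreover have low: "coeff (norm_form ?q a b) i = 0 \<and> coeff T (i - k) = 0" if "i \<ge> 2 * k" for i
  proof (cases "a = 0 \<and> b = 0")
    case True
    then show ?thesis by (auto simp: norm_form_def T_def)
  next
    case False
    then obtain j where "coeff a j \<noteq> 0 \<or> coeff b j \<noteq> 0" by (auto simp: poly_eq_iff)
    then have "j \<in> ?S" "j < k" by (auto simp: defs coeff_poly_cutoff supp split: if_splits)
    \<comment> \<open>Since the lower part is nonzero, the natural number subtraction
      \<open>2 * k - m - 2\<close> is not truncated.\<close>
    then have big: "m + 2 \<le> 2 * k" using k(3) by fastforce
    have low: "degree a \<le> 2 * k - m - 2" "degree b \<le> 2 * k - m - 2"
      using k(3) supp by (intro degree_le; force simp: defs coeff_poly_cutoff)+
    have high: "degree f \<le> m - k" "degree g \<le> m - k"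
      using m by (intro degree_le; simp add: defs coeff_poly_shift)+
    have deg: "degree (x * y) \<le> d + e" if "degree x \<le> d" "degree y \<le> e" for x y :: "int poly" and d e
      using that degree_mult_le[of x y] by linarith
    let ?d = "2 * k - m - 2" and ?e = "m - k"
    \<comment> \<open>As \<open>?d + ?e = k - 2\<close>, even after multiplication by
      \<open>q\<close> the mixed term \<open>T\<close> has degree at most \<open>k - 1\<close>. This
      is where the extra 2 in the gap is spent.\<close>
    have q: "degree ?q \<le> 1" by simp
    have "degree (norm_form ?q a b) \<le> 1 + ?d + ?d"
      unfolding norm_form_def
      by (intro degree_diff_le degree_add_le deg[OF deg[OF q low(1)] low(2)] 
          order_trans[OF deg[OF low(1) low(1)]] order_trans[OF deg[OF low(2) low(2)]]) auto
    then have "coeff (norm_form ?q a b) i = 0"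
      using that big km by (intro coeff_eq_0) linarith
    have two: "degree (2 :: int poly) \<le> 0" by simp
    have "degree T \<le> 1 + (?d + ?e)"
      unfolding T_def
      by (intro degree_diff_le degree_add_le deg[OF q] order_trans[OF deg[OF deg[OF two low(2)] high(2)]]
         order_trans[OF deg[OF deg[OF two low(1)] high(1)]] order_trans[OF deg[OF high(1) low(2)]] deg low high) auto
    then have "coeff T (i - k) = 0"
      using that big km by (intro coeff_eq_0) linarith
    with \<open>coeff (norm_form ?q a b) i = 0\<close> show ?thesis by blast
  qed
  ultimately have top: "coeff (norm_form ?q u' v') (2 * k + j) = coeff (norm_form ?q f g) j" for j
    using low[of "2 * k + j"] by (simp add: coeff_monom_mult)
  \<comment> \<open>The constant coefficients of \<open>f\<close> and \<open>g\<close> are those of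
    the support element \<open>k\<close>.\<close>
  have "\<not> ([:p:] dvd f \<and> [:p:] dvd g)"
  proof
    assume "[:p:] dvd f \<and> [:p:] dvd g"
    then have "p dvd coeff f 0" "p dvd coeff g 0" by (auto simp: const_poly_dvd_iff)
    then have "k \<notin> ?S" by (simp add: defs coeff_poly_shift pair_support_def u' v' dvd_mod_iff)
    then show False using k by blast
  qed
  then obtain j where j: "\<not> p dvd coeff (norm_form ?q f g) j"
    using norm_form_anisotropic[OF p] by (metis const_poly_dvd_iff)
  have "2 * k + j < D"
  proof (rule ccontr)
    assume "\<not> 2 * k + j < D"
    then have "p dvd coeff (norm_form ?q u v) (2 * k + j)" using D by simp
    moreover have "p dvd coeff (norm_form ?q u v - norm_form ?q u' v') (2 * k + j)"
      using norm_form_cong_dvd[OF u'(2) v'(2), of ?q] by (simp only: const_poly_dvd_iff)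
    ultimately have "p dvd coeff (norm_form ?q u' v') (2 * k + j)"
      using dvd_diff_right_iff by (metis coeff_diff)
    then show False using j top by simp
  qed
  then show ?thesis using k(2) unfolding m_def by linarith
qed

section \<open>Growth of degree and of support size\<close>

text \<open>Once the first component carries the top degree of the pair, each step raises that
  degree by exactly one. It remains to see that this dominance is reached after finitely many steps,
  whose number serves as \<open>C\<close>.\<close>

lemma dual_step_degree_growth:
  assumes "pair_support p w \<noteq> {}"
  obtains C where "\<And>t. C \<le> t \<Longrightarrow> \<exists>i\<in>pair_support p ((dual_step [:c, 1:] ^^ t) w). t \<le> i + C"
proof -
  define dom where "dom d w \<longleftrightarrow> \<not> p dvd coeff (fst w) d \<and>
    (\<forall>i>d. p dvd coeff (fst w) i \<and> p dvd coeff (snd w) i)" for d and w :: "int poly \<times> int poly"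
  let ?s = "dual_step [:c, 1:] :: int poly \<times> int poly \<Rightarrow> _"
  have dom_step: "dom (Suc d) (?s w)" if "dom d w" for d w
    using that by (auto simp: dom_def dual_step_def coeff_pCons dvd_add_left_iff dvd_add_right_iff split: nat.split)
  have dom_funpow: "dom (d + t) ((?s ^^ t) w)" if "dom d w" for d t w
    using that by (induction t) (auto intro: dom_step)
  \<comment> \<open>Induction on a bound for the degree of the second component. If the first one is
    not dominant, its degree is strictly smaller, and the step moves it to second place.\<close>
  have "\<exists>d t. dom d ((?s ^^ t) w)" if "pair_support p w \<noteq> {}" "\<forall>i\<ge>n. p dvd coeff (snd w) i" for w n
    using that
  proof (induction n arbitrary: w)
    case 0
    define d where "d = Max (pair_support p w)"
    have d: "d \<in> pair_support p w" "\<And>i. i > d \<Longrightarrow> i \<notin> pair_support p w"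
      using "0.prems"(1) finite_pair_support Max_in Max_ge unfolding d_def by (blast, meson finite_pair_support Max_ge not_le)
    then have "dom d ((?s ^^ 0) w)" using 0 by (auto simp: dom_def pair_support_def)
    then show ?case by blast
  next
    case (Suc n)
    define d where "d = Max (pair_support p w)"
    have d: "d \<in> pair_support p w" "\<And>i. i > d \<Longrightarrow> i \<notin> pair_support p w"
      using Suc.prems(1) finite_pair_support Max_in Max_ge unfolding d_def by (blast, meson finite_pair_support Max_ge not_le)
    show ?case
    proof (cases "p dvd coeff (fst w) d")
      case False
      then have "dom d ((?s ^^ 0) w)" using d by (auto simp: dom_def pair_support_def)
      then show ?thesis by blast
    next
      case True
      have "\<not> p dvd coeff (snd w) d" using d True by (simp add: pair_support_def)
      then have "d < Suc n" using Suc.prems(2) by (meson not_le)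
      then have u: "\<forall>i\<ge>n. p dvd coeff (fst w) i"
        using d True by (metis (no_types, lifting) le_less less_Suc_eq_le mem_Collect_eq order_le_less_trans pair_support_def)
      \<comment> \<open>The dual step is invertible, so it cannot annihilate a nonzero pair; here
        \<open>snd w\<close> is recovered from the image.\<close>
      have "pair_support p (?s w) \<noteq> {}"
      proof
        assume "pair_support p (?s w) = {}"
        then have all: "p dvd coeff (fst w) i" "p dvd coeff ([:c, 1:] * fst w + snd w) i" for i
          by (auto simp: pair_support_def dual_step_def simp del: mult_pCons_left)
        then have "[:p:] dvd [:c, 1:] * fst w" "[:p:] dvd [:c, 1:] * fst w + snd w"
          by (auto simp only: const_poly_dvd_iff intro: dvd_mult)
          (metis all(1) const_poly_dvd_iff dvd_mult)
        then have "[:p:] dvd snd w" by (simp only: dvd_add_right_iff)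
        then show False using \<open>\<not> p dvd coeff (snd w) d\<close> by (simp add: const_poly_dvd_iff)
      qed
      moreover have "\<forall>i\<ge>n. p dvd coeff (snd (?s w)) i" using u by (simp add: dual_step_def)
      ultimately obtain d t where "dom d ((?s ^^ t) (?s w))" using Suc.IH by blast
      then have "dom d ((?s ^^ Suc t) w)" by (simp only: funpow_Suc_right o_apply)
      then show ?thesis by blast
    qed
  qed
  moreover have "\<forall>i\<ge>Suc (degree (snd w)). p dvd coeff (snd w) i" by (auto simp: coeff_eq_0)
  ultimately obtain d t0 where "dom d ((?s ^^ t0) w)" using assms by blast
  show thesis
  proof (rule that[of t0])
    fix t assume t: "t0 \<le> t"
    have "dom (d + (t - t0)) ((?s ^^ t) w)"
      using dom_funpow[OF \<open>dom d ((?s ^^ t0) w)\<close>, of "t - t0"] t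
      by (simp add: funpow_add[unfolded o_def, THEN fun_cong, symmetric])
    then have "d + (t - t0) \<in> pair_support p ((?s ^^ t) w)"
      by (simp add: dom_def pair_support_def)
    then show "\<exists>i\<in>pair_support p ((?s ^^ t) w). t \<le> i + t0" by (rule bexI[rotated]) simp
  qed
qed

text \<open>The top of the support is at least \<open>t - C\<close>, but below \<open>D\<close> plus
  2 to the power of its cardinality. Hence the cardinality grows at least logarithmically in
  \<open>t\<close>.\<close>

lemma card_pair_support_tendsto:
  assumes p: "prime p" and ne: "pair_support p w \<noteq> {}"
  shows "filterlim (\<lambda>t. card (pair_support p ((dual_step [:c, 1:] ^^ t) w))) at_top sequentially"
  unfolding filterlim_at_top eventually_sequentially
proof
  fix R :: nat
  let ?w = "\<lambda>t. (dual_step [:c, 1:] ^^ t) w" and ?q = "[:c, 1:]"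
  obtain C where C: "\<And>t. C \<le> t \<Longrightarrow> \<exists>i\<in>pair_support p (?w t). t \<le> i + C"
    using dual_step_degree_growth[OF ne] by blast
  \<comment> \<open>One \<open>D\<close> serves all \<open>t\<close>, because the norm changes only
    by a sign along the orbit.\<close>
  define D where "D = Suc (degree (norm_form ?q (fst w) (snd w)))"
  have "R \<le> card (pair_support p (?w t))" if t: "C + D + 2 ^ R \<le> t" for t
  proof -
    obtain i where i: "i \<in> pair_support p (?w t)" "t \<le> i + C" using C[of t] t by auto
    have "norm_form ?q (fst (?w t)) (snd (?w t)) = smult ((-1) ^ t) (norm_form ?q (fst w) (snd w))"
      by (simp only: norm_form_dual_step_funpow) (cases "even t"; simp)
    then have "coeff (norm_form ?q (fst (?w t)) (snd (?w t))) j = 0" if "D \<le> j" for j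
      using that by (simp add: D_def coeff_eq_0 del: mult_pCons_left)
    then have "Max (pair_support p (?w t)) < D + 2 ^ card (pair_support p (?w t))"
      using pair_support_bound[OF p, of "fst (?w t)" "snd (?w t)" D c] i by auto
    moreover have "i \<le> Max (pair_support p (?w t))" using i by (simp add: finite_pair_support)
    ultimately have "(2::nat) ^ R < 2 ^ card (pair_support p (?w t))" using i t by linarith
    then show ?thesis using power_less_imp_less_exp by (metis less_imp_le one_less_numeral_iff semiring_norm(76))
  qed
  then show "\<exists>N. \<forall>t\<ge>N. R \<le> card (pair_support p (?w t))" by blast
qed

section \<open>Weak-star convergence from cylinder probabilities\<close>

definition cylinder :: "'a monoid \<Rightarrow> int set \<Rightarrow> (int \<Rightarrow> 'a) \<Rightarrow> (int \<Rightarrow> 'a) set" where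
  "cylinder A S y = {x \<in> carrier (config_group A). \<forall>k\<in>S. x k = y k}"

section \<open>Cylinders and Borel sets\<close>

lemma openin_cylinder:
  assumes "finite S" "\<And>k. k \<in> S \<Longrightarrow> y k \<in> carrier A"
  shows "openin (config_topology A) (cylinder A S y)"
proof -
  have "cylinder A S y = (\<Pi>\<^sub>E k\<in>UNIV. if k \<in> S then {y k} else carrier A)"
  proof (intro equalityI subsetI)
    fix x assume "x \<in> (\<Pi>\<^sub>E k\<in>UNIV. if k \<in> S then {y k} else carrier A)"
    then have x: "x k \<in> (if k \<in> S then {y k} else carrier A)" for k
      by (simp only: PiE_iff) blast
    have "x k \<in> carrier A" for k
      using x[of k] assms(2)[of k] by (cases "k \<in> S") auto
    moreover have "x k = y k" if "k \<in> S" for k using x[of k] that by simp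
    ultimately show "x \<in> cylinder A S y" by (simp add: cylinder_def carrier_config_group PiE_iff)
  qed (simp add: cylinder_def carrier_config_group PiE_iff)
  moreover have "openin (config_topology A) (\<Pi>\<^sub>E k\<in>UNIV. if k \<in> S then {y k} else carrier A)"
    unfolding config_topology_def
  proof (rule product_topology_basis)
    show "finite {k. (if k \<in> S then {y k} else carrier A) \<noteq> topspace (discrete_topology (carrier A))}"
      by (rule finite_subset[OF _ assms(1)]) auto
  qed (use assms(2) in auto)
  ultimately show ?thesis by simp
qed

lemma space_config_borel: "space (config_borel A) = carrier (config_group A)"
  by (auto simp: config_borel_def topspace_config_topology carrier_config_group space_measure_of_conv)

lemma openin_sets_config_borel: "openin (config_topology A) U \<Longrightarrow> U \<in> sets (config_borel A)"
  using openin_subset[of "config_topology A"]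
  by (auto simp: config_borel_def topspace_config_topology)

lemma cylinder_sets:
  assumes "finite S" "\<And>k. k \<in> S \<Longrightarrow> y k \<in> carrier A"
  shows "cylinder A S y \<in> sets (config_borel A)"
  using assms by (intro openin_sets_config_borel openin_cylinder)

lemma continuous_map_config_borel_measurable:
  fixes f :: "(int \<Rightarrow> 'a) \<Rightarrow> 'b::topological_space"
  assumes "continuous_map (config_topology A) euclidean f"
  shows "f \<in> borel_measurable (config_borel A)"
proof (rule borel_measurableI)
  fix S :: "'b set" assume "open S"
  then have "openin (config_topology A) {x \<in> topspace (config_topology A). f x \<in> S}"
    using assms by (intro openin_continuous_map_preimage) auto
  moreover have "f -` S \<inter> space (config_borel A) = {x \<in> topspace (config_topology A). f x \<in> S}"
    by (auto simp: space_config_borel topspace_config_topology carrier_config_group)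
  ultimately show "f -` S \<inter> space (config_borel A) \<in> sets (config_borel A)"
    by (simp add: openin_sets_config_borel)
qed

section \<open>Approximation of continuous functions by cylinder functions\<close>

text \<open>Uniform continuity by compactness: around each point some cylinder keeps
  \<open>f\<close> within half of \<epsilon>, finitely many of these cover the space, and the
  largest of their windows works everywhere.\<close>

lemma continuous_map_config_uniform:
  fixes f :: "(int \<Rightarrow> 'a) \<Rightarrow> real"
  assumes fin: "finite (carrier A)" and f: "continuous_map (config_topology A) euclideanreal f" and "\<epsilon> > 0"
  obtains n :: nat where
    "\<And>x y. \<lbrakk>x \<in> carrier (config_group A); y \<in> cylinder A {- int n..int n} x\<rbrakk> \<Longrightarrow> \<bar>f x - f y\<bar> < \<epsilon>"
proof -
  let ?T = "config_topology A" and ?C = "carrier (config_group A)" and ?I = "\<lambda>n::nat. {- int n..int n}"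
  have top: "topspace ?T = ?C" by (simp add: topspace_config_topology carrier_config_group)
  have cell: "x k \<in> carrier A" if "x \<in> ?C" for x k using that by (auto simp: carrier_config_group)
  have "\<exists>n. \<forall>y\<in>cylinder A (?I n) x. \<bar>f y - f x\<bar> < \<epsilon> / 2" if x: "x \<in> ?C" for x
  proof -
    define U where "U = {y \<in> topspace ?T. f y \<in> ball (f x) (\<epsilon> / 2)}"
    have U: "openin ?T U"
      unfolding U_def using f by (rule openin_continuous_map_preimage) simp
    have "x \<in> U" using x \<open>\<epsilon> > 0\<close> by (simp add: U_def top)
    then obtain V where V: "x \<in> Pi\<^sub>E UNIV V" "finite {i. V i \<noteq> carrier A}" "Pi\<^sub>E UNIV V \<subseteq> U"
      using product_topology_open_contains_basis[OF U[unfolded config_topology_def] \<open>x \<in> U\<close>] by auto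
    obtain n :: nat where n: "{i. V i \<noteq> carrier A} \<subseteq> ?I n"
    proof -
      have "{i. V i \<noteq> carrier A} \<subseteq> ?I (nat (Max (insert 0 (abs ` {i. V i \<noteq> carrier A}))))"
      proof
        fix i assume "i \<in> {i. V i \<noteq> carrier A}"
        then have "\<bar>i\<bar> \<le> Max (insert 0 (abs ` {i. V i \<noteq> carrier A}))"
          using V(2) by (intro Max_ge) auto
        then show "i \<in> ?I (nat (Max (insert 0 (abs ` {i. V i \<noteq> carrier A}))))" by auto
      qed
      then show thesis using that by blast
    qed
    have "cylinder A (?I n) x \<subseteq> Pi\<^sub>E UNIV V"
    proof
      fix z assume z: "z \<in> cylinder A (?I n) x"
      have "z k \<in> V k" for k
      proof (cases "V k = carrier A")
        case True
        then show ?thesis using z by (auto simp: cylinder_def cell)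
      next
        case False
        then have "z k = x k" using z n by (auto simp: cylinder_def)
        then show ?thesis using V(1) by (auto simp: PiE_iff)
      qed
      then show "z \<in> Pi\<^sub>E UNIV V" by auto
    qed
    then have "\<bar>f y - f x\<bar> < \<epsilon> / 2" if "y \<in> cylinder A (?I n) x" for y
    proof -
      have "y \<in> U" using V(3) that \<open>_ \<subseteq> Pi\<^sub>E UNIV V\<close> by blast
      then show ?thesis by (simp add: U_def dist_real_def abs_minus_commute)
    qed
    then show ?thesis by blast
  qed
  then have "\<exists>N. \<forall>x\<in>?C. \<forall>y\<in>cylinder A (?I (N x)) x. \<bar>f y - f x\<bar> < \<epsilon> / 2"
    by (intro bchoice) blast
  then obtain N where N: "\<And>x y. x \<in> ?C \<Longrightarrow> y \<in> cylinder A (?I (N x)) x \<Longrightarrow> \<bar>f y - f x\<bar> < \<epsilon> / 2"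
    by blast
  have "compact_space ?T"
    unfolding config_topology_def by (rule compact_space_product_topology[THEN iffD2]) (simp add: fin compact_space_discrete_topology)
  obtain \<F> where \<F>: "finite \<F>" "\<F> \<subseteq> (\<lambda>x. cylinder A (?I (N x)) x) ` ?C" "topspace ?T \<subseteq> \<Union>\<F>"
  proof -
    have "topspace ?T \<subseteq> \<Union>((\<lambda>x. cylinder A (?I (N x)) x) ` ?C)"
      by (auto simp: top cylinder_def)
    moreover have "openin ?T U" if "U \<in> (\<lambda>x. cylinder A (?I (N x)) x) ` ?C" for U
      using that by (auto intro!: openin_cylinder cell)
    ultimately have "\<exists>\<F>. finite \<F> \<and> \<F> \<subseteq> (\<lambda>x. cylinder A (?I (N x)) x) ` ?C \<and> topspace ?T \<subseteq> \<Union>\<F>"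
      using \<open>compact_space ?T\<close>[unfolded compact_space_alt, rule_format] by simp
    then show thesis using that by blast
  qed
  obtain X where X: "X \<subseteq> ?C" "finite X" "\<F> = (\<lambda>x. cylinder A (?I (N x)) x) ` X"
    using finite_subset_image[OF \<F>(1,2)] by blast
  \<comment> \<open>Agreement on the largest window implies agreement on each smaller one. Inserting
    0 keeps \<open>Max\<close> meaningful for an empty \<open>X\<close>.\<close>
  define n where "n = Max (insert 0 (N ` X))"
  show thesis
  proof (rule that[of n])
    fix x y assume x: "x \<in> ?C" and y: "y \<in> cylinder A (?I n) x"
    then obtain z where z: "z \<in> X" "x \<in> cylinder A (?I (N z)) z" using \<F>(3) X top by auto
    have "N z \<le> n" unfolding n_def using X z by (intro Max_ge) auto
    then have "y \<in> cylinder A (?I (N z)) z" using y z by (auto simp: cylinder_def)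
    then have "\<bar>f x - f z\<bar> < \<epsilon> / 2" "\<bar>f y - f z\<bar> < \<epsilon> / 2" using N z X by blast+
    then show "\<bar>f x - f y\<bar> < \<epsilon>" by linarith
  qed
qed

text \<open>A continuous \<open>f\<close> is uniformly close to a finite combination of cylinder
  indicators, whose integrals converge by hypothesis; a three-epsilon estimate concludes.\<close>

lemma weak_star_tendsto_cylinders:
  assumes fin: "finite (carrier A)"
    and M: "\<And>t. prob_space (M t)" "\<And>t. sets (M t) = sets (config_borel A)"
    and N: "prob_space N" "sets N = sets (config_borel A)"
    and lim: "\<And>n y. y \<in> carrier (config_group A) \<Longrightarrow>
      (\<lambda>t. measure (M t) (cylinder A {- int n..int n} y)) \<longlonglongrightarrow> measure N (cylinder A {- int n..int n} y)"
  shows "weak_star_tendsto A M N"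
  unfolding weak_star_tendsto_def
proof (intro allI impI)
  fix f :: "(int \<Rightarrow> 'a) \<Rightarrow> real" assume f: "continuous_map (config_topology A) euclideanreal f"
  let ?C = "carrier (config_group A)" and ?I = "\<lambda>n::nat. {- int n..int n}"
  note f_meas = continuous_map_config_borel_measurable[OF f]
  show "(\<lambda>t. \<integral>x. f x \<partial>M t) \<longlonglongrightarrow> (\<integral>x. f x \<partial>N)"
  proof (rule metric_LIMSEQ_I)
    fix \<epsilon> :: real assume "\<epsilon> > 0"
    then have "\<epsilon> / 3 > 0" by simp
    then obtain n :: nat where n: "\<And>x y. \<lbrakk>x \<in> ?C; y \<in> cylinder A (?I n) x\<rbrakk> \<Longrightarrow> \<bar>f x - f y\<bar> < \<epsilon> / 3"
      using continuous_map_config_uniform[OF fin f] by metis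
    \<comment> \<open>A canonical representative of the cylinder of \<open>x\<close>: outside the
      window every cell gets one fixed letter, so only finitely many representatives occur.\<close>
    define r where "r x k = (if k \<in> ?I n then x k else SOME a. a \<in> carrier A)" for x :: "int \<Rightarrow> 'a" and k
    define Z where "Z = r ` ?C"
    have finZ: "finite Z"
    proof (rule finite_subset)
      show "Z \<subseteq> (\<lambda>x. r x) ` (\<Pi>\<^sub>E k\<in>?I n. carrier A)"
      proof
        fix z assume "z \<in> Z"
        then obtain x where "x \<in> ?C" "z = r x" by (auto simp: Z_def)
        then have "z = r (restrict x (?I n))" "restrict x (?I n) \<in> (\<Pi>\<^sub>E k\<in>?I n. carrier A)"
          by (auto simp: r_def carrier_config_group)
        then show "z \<in> (\<lambda>x. r x) ` (\<Pi>\<^sub>E k\<in>?I n. carrier A)" by blast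
      qed
    qed (auto intro!: finite_PiE fin)
    have rC: "r x \<in> ?C" if "x \<in> ?C" for x
      using that some_in_eq[of "carrier A"] by (auto simp: r_def carrier_config_group PiE_iff)
    have ZC: "z k \<in> carrier A" "z \<in> ?C" if "z \<in> Z" for z k
      using that rC by (auto simp: Z_def carrier_config_group PiE_iff)
    have cyl_r: "x \<in> cylinder A (?I n) z \<longleftrightarrow> z = r x" if "x \<in> ?C" "z \<in> Z" for x z
      using that by (auto simp: cylinder_def Z_def r_def fun_eq_iff)
    define g where "g x = (\<Sum>z\<in>Z. f z * indicator (cylinder A (?I n) z) x)" for x
    have g: "g x = f (r x)" if "x \<in> ?C" for x
    proof -
      have "g x = (\<Sum>z\<in>Z. if z = r x then f z else 0)"
        unfolding g_def by (rule sum.cong) (auto simp: indicator_def cyl_r that)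
      then show ?thesis using finZ that by (simp add: sum.delta Z_def)
    qed
    have fg: "\<bar>f x - g x\<bar> \<le> \<epsilon> / 3" if "x \<in> ?C" for x
      using n[of x "r x"] that rC g by (simp add: cylinder_def r_def less_imp_le)
    have cyl_meas: "cylinder A (?I n) z \<in> sets (config_borel A)" if "z \<in> Z" for z
      using that ZC by (intro cylinder_sets) auto
    \<comment> \<open>The error bound does not depend on the probability measure, so it applies to
      every \<open>M t\<close> and to \<open>N\<close> alike.\<close>
    have main: "\<bar>(\<integral>x. f x \<partial>P) - (\<Sum>z\<in>Z. f z * measure P (cylinder A (?I n) z))\<bar> \<le> \<epsilon> / 3"
      if P: "prob_space P" "sets P = sets (config_borel A)" for P
    proof -
      interpret P: prob_space P by (rule P)
      have spP: "space P = ?C" using sets_eq_imp_space_eq[OF P(2)] by (simp add: space_config_borel)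
      have ind: "integrable P (indicator (cylinder A (?I n) z) :: _ \<Rightarrow> real)" if "z \<in> Z" for z
        using that cyl_meas by (intro integrable_real_indicator) (auto simp: P P.emeasure_eq_measure)
      have int_g: "integrable P g"
        unfolding g_def using ind by (intro Bochner_Integration.integrable_sum integrable_mult_right) auto
      have "(\<integral>x. g x \<partial>P) = (\<Sum>z\<in>Z. f z * measure P (cylinder A (?I n) z))"
        unfolding g_def using ind cyl_meas P by (subst Bochner_Integration.integral_sum) (auto simp: spP cylinder_def intro!: sum.cong arg_cong[where f = "measure P"])
      moreover have "f \<in> borel_measurable P" using f_meas P(2) by (simp cong: measurable_cong_sets)
      moreover have int_d: "integrable P (\<lambda>x. f x - g x)"
        using fg spP calculation(2) int_g by (intro P.integrable_const_bound[where B = "\<epsilon> / 3"]) (auto intro!: AE_I2)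
      moreover have "\<bar>\<integral>x. f x - g x \<partial>P\<bar> \<le> \<epsilon> / 3"
      proof -
        have "\<bar>\<integral>x. f x - g x \<partial>P\<bar> \<le> (\<integral>x. \<bar>f x - g x\<bar> \<partial>P)"
          using integral_norm_bound[of P "\<lambda>x. f x - g x"] by simp
        also have "\<dots> \<le> (\<integral>x. \<epsilon> / 3 \<partial>P)"
          using int_d fg spP by (intro integral_mono) auto
        finally show ?thesis by (simp add: P.prob_space)
      qed
      moreover have "(\<integral>x. f x \<partial>P) = (\<integral>x. f x - g x \<partial>P) + (\<integral>x. g x \<partial>P)"
        using Bochner_Integration.integral_add[OF int_d int_g] by simp
      ultimately show ?thesis by simp
    qed
    have sum_lim: "(\<lambda>t. \<Sum>z\<in>Z. f z * measure (M t) (cylinder A (?I n) z)) \<longlonglongrightarrow> (\<Sum>z\<in>Z. f z * measure N (cylinder A (?I n) z))"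
      by (intro tendsto_sum tendsto_mult tendsto_const lim ZC)
    obtain T where T: "\<And>t. t \<ge> T \<Longrightarrow>
        \<bar>(\<Sum>z\<in>Z. f z * measure (M t) (cylinder A (?I n) z)) - (\<Sum>z\<in>Z. f z * measure N (cylinder A (?I n) z))\<bar> < \<epsilon> / 3"
      using metric_LIMSEQ_D[OF sum_lim \<open>\<epsilon> / 3 > 0\<close>] unfolding dist_real_def by blast
    have "dist (\<integral>x. f x \<partial>M t) (\<integral>x. f x \<partial>N) < \<epsilon>" if "t \<ge> T" for t
      using main[OF M, of t] main[OF N] T[OF that] unfolding dist_real_def by linarith
    then show "\<exists>T. \<forall>t\<ge>T. dist (\<integral>x. f x \<partial>M t) (\<integral>x. f x \<partial>N) < \<epsilon>" by blast
  qed
qed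

section \<open>Characters as pairs of polynomials\<close>

text \<open>The standard additive character modulo \<open>p\<close>, taken on all integers so that
  coefficients need not be reduced.\<close>

definition root_char :: "nat \<Rightarrow> int \<Rightarrow> complex" where
  "root_char p a = cis (2 * pi * (of_int a / of_nat p))"

lemma root_char_0 [simp]: "root_char p 0 = 1"
  by (simp add: root_char_def)

lemma root_char_add: "root_char p (a + b) = root_char p a * root_char p b"
  by (simp add: root_char_def cis_mult add_divide_distrib ring_distribs)

lemma norm_root_char [simp]: "cmod (root_char p a) = 1"
  by (simp add: root_char_def)

lemma root_char_sum: "root_char p (\<Sum>i\<in>S. f i) = (\<Prod>i\<in>S. root_char p (f i))"
  by (induction S rule: infinite_finite_induct) (simp_all add: root_char_add)

lemma root_char_of_nat_mult: "root_char p (int m * a) = root_char p a ^ m"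
  by (induction m) (simp_all add: root_char_add ring_distribs)

lemma root_char_eq_1_iff:
  assumes "p > 0"
  shows "root_char p a = 1 \<longleftrightarrow> int p dvd a"
proof
  assume "root_char p a = 1"
  then have "cos (2 * pi * (of_int a / of_nat p)) = 1" by (simp add: root_char_def complex_eq_iff)
  then obtain n :: int where "2 * pi * (of_int a / of_nat p) = of_int n * 2 * pi"
    by (auto simp: cos_one_2pi_int)
  then have "of_int a = (of_int (int p * n) :: real)" using assms by (simp add: field_simps)
  then have "a = int p * n" by (simp only: of_int_eq_iff)
  then show "int p dvd a" by simp
next
  assume "int p dvd a"
  then obtain n where "a = int p * n" by blast
  then show "root_char p a = 1" using assms by (simp add: root_char_def)
qed

lemma root_char_cong:
  assumes "p > 0" "a mod int p = b mod int p"
  shows "root_char p a = root_char p b"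
proof -
  have "int p dvd a - b" using assms(2) by (simp only: mod_eq_dvd_iff)
  then have "root_char p (a - b) = 1" using assms(1) by (simp add: root_char_eq_1_iff)
  then show ?thesis using root_char_add[of p "a - b" b] by simp
qed

text \<open>Orthogonality of characters: if \<open>p\<close> does not divide \<open>a\<close>, this
  is a full geometric sum whose ratio is a \<open>p\<close>-th root of unity other than 1.\<close>

lemma sum_root_char:
  assumes "p > 0"
  shows "(\<Sum>m<p. root_char p (int m * a)) = (if int p dvd a then of_nat p else 0)"
proof (cases "int p dvd a")
  case True
  then show ?thesis using assms by (simp add: root_char_of_nat_mult root_char_eq_1_iff[THEN iffD2])
next
  case False
  then have "root_char p a \<noteq> 1" using assms by (simp add: root_char_eq_1_iff)
  moreover have "root_char p a ^ p = 1"
    using assms by (simp flip: root_char_of_nat_mult add: root_char_eq_1_iff)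
  ultimately show ?thesis using False by (simp add: root_char_of_nat_mult geometric_sum)
qed

section \<open>Pairing polynomials with configurations\<close>

text \<open>Under this bilinear pairing, multiplication of the polynomial by the variable is dual to
  the shift of the sequence; see \<open>coeff_pairing_pCons\<close>.\<close>

definition coeff_pairing :: "int poly \<Rightarrow> (nat \<Rightarrow> int) \<Rightarrow> int" where
  "coeff_pairing u f = (\<Sum>i\<le>degree u. coeff u i * f i)"

text \<open>Polynomials of different degrees can thus be paired over one common range.\<close>

lemma coeff_pairing_eq:
  assumes "degree u \<le> n"
  shows "coeff_pairing u f = (\<Sum>i\<le>n. coeff u i * f i)"
  unfolding coeff_pairing_def using assms
  by (intro sum.mono_neutral_left) (auto simp: coeff_eq_0)

lemma coeff_pairing_add: "coeff_pairing (u + v) f = coeff_pairing u f + coeff_pairing v f"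
proof -
  let ?n = "max (degree u) (degree v)"
  have "degree (u + v) \<le> ?n" by (rule degree_add_le_max)
  then show ?thesis
    by (simp add: coeff_pairing_eq[of _ ?n] sum.distrib ring_distribs)
qed

lemma coeff_pairing_add_right: "coeff_pairing u (\<lambda>i. f i + g i) = coeff_pairing u f + coeff_pairing u g"
  by (simp add: coeff_pairing_def sum.distrib ring_distribs)

lemma coeff_pairing_monom [simp]: "coeff_pairing (monom a n) f = a * f n"
proof -
  have "coeff_pairing (monom a n) f = (\<Sum>i\<le>n. coeff (monom a n) i * f i)"
    by (rule coeff_pairing_eq) (rule degree_monom_le)
  also have "\<dots> = (\<Sum>i\<le>n. if i = n then a * f n else 0)"
    by (rule sum.cong) auto
  finally show ?thesis by simp
qed

lemma coeff_pairing_pCons: "coeff_pairing (pCons a u) f = a * f 0 + coeff_pairing u (\<lambda>i. f (Suc i))"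
proof -
  have "coeff_pairing (pCons a u) f = (\<Sum>i\<le>Suc (degree u). coeff (pCons a u) i * f i)"
    by (rule coeff_pairing_eq) (rule degree_pCons_le)
  also have "\<dots> = a * f 0 + (\<Sum>i\<le>degree u. coeff u i * f (Suc i))"
    by (simp add: sum.atMost_Suc_shift del: sum.atMost_Suc)
  finally show ?thesis by (simp add: coeff_pairing_def)
qed

lemma coeff_pairing_smult: "coeff_pairing (smult a u) f = a * coeff_pairing u f"
  by (simp add: coeff_pairing_eq[of _ "degree u"] degree_smult_le sum_distrib_left mult.assoc)

lemma coeff_pairing_mod: "coeff_pairing u (\<lambda>i. f i mod m) mod m = coeff_pairing u f mod m"
proof -
  have "(\<Sum>i\<le>n. coeff u i * (f i mod m)) mod m = (\<Sum>i\<le>n. coeff u i * f i) mod m" for n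
    by (subst (1 2) mod_sum_eq[symmetric]) (simp add: mod_mult_right_eq)
  then show ?thesis by (simp add: coeff_pairing_def)
qed

text \<open>The pair \<open>w\<close> of Laurent polynomials is encoded by two ordinary polynomials together with the
  position \<open>s\<close> of their constant coefficients.\<close>

definition poly_char :: "nat \<Rightarrow> int \<Rightarrow> int poly \<times> int poly \<Rightarrow> (int \<Rightarrow> int \<times> int) \<Rightarrow> complex" where
  "poly_char p s w c = root_char p
     (coeff_pairing (fst w) (\<lambda>i. fst (c (int i + s))) + coeff_pairing (snd w) (\<lambda>i. snd (c (int i + s))))"

lemma poly_char_add: "poly_char p s (u + u', v + v') c = poly_char p s (u, v) c * poly_char p s (u', v') c"
  by (simp add: poly_char_def coeff_pairing_add flip: root_char_add)
     (simp add: algebra_simps)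

text \<open>Both automata have this local form, \<open>F_ca\<close> with \<open>a = 0\<close> and
  \<open>G_ca\<close> with \<open>a = 1\<close>. By duality, shift plus \<open>a\<close> becomes
  multiplication by \<open>[:a, 1:]\<close>; the base position \<open>s\<close> stays fixed.\<close>

lemma poly_char_local_step:
  assumes "p > 0"
    and \<Phi>: "\<And>z. fst (\<Phi> c z) = (fst (c (z + 1)) + a * fst (c z) + snd (c z)) mod int p"
      "\<And>z. snd (\<Phi> c z) = fst (c z)"
  shows "poly_char p s w (\<Phi> c) = poly_char p s (dual_step [:a, 1:] w) c"
  unfolding poly_char_def
proof (rule root_char_cong[OF assms(1)])
  let ?f = "\<lambda>i. fst (c (int i + s))" and ?g = "\<lambda>i. snd (c (int i + s))"
  have "coeff_pairing (fst w) (\<lambda>i. fst (\<Phi> c (int i + s))) mod int p =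
      coeff_pairing (fst w) (\<lambda>i. ?f (Suc i) + a * ?f i + ?g i) mod int p"
    unfolding \<Phi> coeff_pairing_mod by (simp add: add.commute add.left_commute)
  also have "coeff_pairing (fst w) (\<lambda>i. ?f (Suc i) + a * ?f i + ?g i) =
      coeff_pairing ([:a, 1:] * fst w) ?f + coeff_pairing (fst w) ?g"
    by (simp add: coeff_pairing_add_right coeff_pairing_add coeff_pairing_pCons coeff_pairing_smult)
       (simp add: coeff_pairing_def sum_distrib_left mult.left_commute)
  finally have "coeff_pairing (fst w) (\<lambda>i. fst (\<Phi> c (int i + s))) mod int p =
      (coeff_pairing ([:a, 1:] * fst w) ?f + coeff_pairing (fst w) ?g) mod int p" .
  then show "(coeff_pairing (fst w) (\<lambda>i. fst (\<Phi> c (int i + s))) + coeff_pairing (snd w) (\<lambda>i. snd (\<Phi> c (int i + s)))) mod int p =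
     (coeff_pairing (fst (dual_step [:a, 1:] w)) ?f + coeff_pairing (snd (dual_step [:a, 1:] w)) ?g) mod int p"
    unfolding \<Phi>(2) dual_step_def fst_conv snd_conv coeff_pairing_add
    by (subst mod_add_left_eq[symmetric]) (simp only: mod_simps ac_simps)
qed

lemma poly_char_F_ca: "p > 0 \<Longrightarrow> poly_char p s w (F_ca p c) = poly_char p s (dual_step [:0, 1:] w) c"
  by (rule poly_char_local_step) (simp_all add: F_ca_def integer_mod_group_def)

lemma poly_char_G_ca: "p > 0 \<Longrightarrow> poly_char p s w (G_ca p c) = poly_char p s (dual_step [:1, 1:] w) c"
  by (rule poly_char_local_step) (simp_all add: G_ca_def integer_mod_group_def mod_simps)

lemma carrier_Zp2: "p > 0 \<Longrightarrow> carrier (Zp2 p) = {0..<int p} \<times> {0..<int p}"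
  by (simp add: Zp2_def carrier_integer_mod_group)

text \<open>A converse of \<open>config_character_factors\<close>. Continuity holds because every
  function on a discrete alphabet is continuous and only finitely many factors enter.\<close>

lemma config_character_of_factors:
  assumes X: "character_factors A \<xi> X" and "monoid A"
  shows "config_character A \<xi>"
proof -
  let ?S = "nontrivial_cells A X" and ?C = "carrier (config_group A)"
  have hom: "X k \<in> hom A circle_group" and fin: "finite ?S"
    and \<xi>: "\<And>x. x \<in> ?C \<Longrightarrow> \<xi> x = (\<Prod>k\<in>?S. X k (x k))" for k
    using X by (auto simp: character_factors_def)
  have cell: "x k \<in> carrier A" if "x \<in> ?C" for x k using that by (auto simp: carrier_config_group)
  have closed: "(\<lambda>k. x k \<otimes>\<^bsub>A\<^esub> y k) \<in> ?C" if "x \<in> ?C" "y \<in> ?C" for x y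
    using that \<open>monoid A\<close> by (auto simp: carrier_config_group PiE_iff monoid.m_closed)
  have norm: "cmod (\<xi> x) = 1" if "x \<in> ?C" for x
  proof -
    have "cmod (X k (x k)) = 1" for k using hom_in_carrier[OF hom cell[OF that]] by simp
    then show ?thesis by (simp add: \<xi>[OF that] flip: prod_norm)
  qed
  have "\<xi> \<in> hom (config_group A) circle_group"
  proof (rule homI)
    fix x y assume xy: "x \<in> ?C" "y \<in> ?C"
    have "X k (x k \<otimes>\<^bsub>A\<^esub> y k) = X k (x k) * X k (y k)" for k
      using hom_mult[OF hom cell[OF xy(1)] cell[OF xy(2)]] by simp
    then show "\<xi> (x \<otimes>\<^bsub>config_group A\<^esub> y) = \<xi> x \<otimes>\<^bsub>circle_group\<^esub> \<xi> y"
      using xy closed[OF xy] by (simp add: mult_config_group \<xi> prod.distrib)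
  qed (simp add: norm)
  moreover have "continuous_map (config_topology A) euclidean \<xi>"
  proof (rule continuous_map_eq)
    have "continuous_map (config_topology A) euclidean (\<lambda>x. X k (x k))" for k
      using continuous_map_compose[OF continuous_map_cell, of A euclidean "X k"] by (simp add: o_def)
    then show "continuous_map (config_topology A) euclidean (\<lambda>x. \<Prod>k\<in>?S. X k (x k))"
      using fin by (simp add: continuous_map_atin tendsto_prod)
  qed (simp add: \<xi> topspace_config_topology carrier_config_group)
  ultimately show ?thesis
    using norm by (simp add: config_character_def continuous_map_in_subtopology image_subset_iff topspace_config_topology carrier_config_group)
qed

text \<open>Cell \<open>k\<close> reads the two coefficients of index \<open>k - s\<close>, and its
  factor is trivial exactly when both are divisible by \<open>p\<close>. This identifies the rank
  with the size of \<open>pair_support\<close>.\<close>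

lemma poly_char_factors:
  fixes w :: "int poly \<times> int poly" and s :: int
  assumes "p > 1"
  defines "X \<equiv> \<lambda>k a. if s \<le> k then root_char p (coeff (fst w) (nat (k - s)) * fst a + coeff (snd w) (nat (k - s)) * snd a) else 1"
  shows "character_factors (Zp2 p) (poly_char p s w) X"
    and "nontrivial_cells (Zp2 p) X = (\<lambda>i. int i + s) ` pair_support (int p) w"
proof -
  have p: "p > 0" using assms by simp
  show cells: "nontrivial_cells (Zp2 p) X = (\<lambda>i. int i + s) ` pair_support (int p) w"
  proof (intro equalityI subsetI)
    fix k assume "k \<in> nontrivial_cells (Zp2 p) X"
    then obtain a where a: "X k a \<noteq> 1" by (auto simp: nontrivial_cells_def)
    then have "s \<le> k" by (rule contrapos_np) (simp add: X_def)
    moreover have "nat (k - s) \<in> pair_support (int p) w"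
      using a p by (auto simp: X_def pair_support_def root_char_eq_1_iff split: if_splits)
    ultimately show "k \<in> (\<lambda>i. int i + s) ` pair_support (int p) w"
      by (intro image_eqI[of _ _ "nat (k - s)"]) auto
  next
    fix k assume "k \<in> (\<lambda>i. int i + s) ` pair_support (int p) w"
    then obtain i where i: "k = int i + s" "i \<in> pair_support (int p) w" by blast
    \<comment> \<open>The two generators of the alphabet test the two coefficients
      separately.\<close>
    then have "X k (1, 0) \<noteq> 1 \<or> X k (0, 1) \<noteq> 1"
      using p by (simp add: X_def pair_support_def root_char_eq_1_iff)
    moreover have "(1, 0) \<in> carrier (Zp2 p)" "(0, 1) \<in> carrier (Zp2 p)"
      using assms(1) by (simp_all add: carrier_Zp2)
    ultimately show "k \<in> nontrivial_cells (Zp2 p) X"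
      unfolding nontrivial_cells_def by blast
  qed
  have "X k \<in> hom (Zp2 p) circle_group" for k
  proof (rule homI)
    fix a b
    show "X k (a \<otimes>\<^bsub>Zp2 p\<^esub> b) = X k a \<otimes>\<^bsub>circle_group\<^esub> X k b"
    proof (cases "s \<le> k")
      case True
      let ?u = "coeff (fst w) (nat (k - s))" and ?v = "coeff (snd w) (nat (k - s))"
      have "root_char p (?u * ((fst a + fst b) mod int p) + ?v * ((snd a + snd b) mod int p)) =
          root_char p ((?u * fst a + ?v * snd a) + (?u * fst b + ?v * snd b))"
        by (rule root_char_cong[OF p], rule trans[OF mod_add_cong[OF mod_mult_right_eq mod_mult_right_eq]])
           (simp add: algebra_simps)
      then show ?thesis
        using True p by (simp add: X_def Zp2_def mult_DirProd' integer_mod_group_def root_char_add)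
    qed (simp add: X_def)
  qed (simp add: X_def)
  moreover have "poly_char p s w x = (\<Prod>k\<in>nontrivial_cells (Zp2 p) X. X k (x k))" for x
  proof -
    define n where "n = max (degree (fst w)) (degree (snd w))"
    have "poly_char p s w x = (\<Prod>i\<le>n. X (int i + s) (x (int i + s)))"
      by (simp add: poly_char_def coeff_pairing_eq[of _ n] n_def X_def flip: root_char_sum sum.distrib)
    also have "\<dots> = (\<Prod>i\<in>pair_support (int p) w. X (int i + s) (x (int i + s)))"
    proof (rule prod.mono_neutral_right)
      show "pair_support (int p) w \<subseteq> {..n}"
      proof
        fix i assume "i \<in> pair_support (int p) w"
        then have "coeff (fst w) i \<noteq> 0 \<or> coeff (snd w) i \<noteq> 0" by (auto simp: pair_support_def)
        then show "i \<in> {..n}" by (auto simp: n_def le_max_iff_disj dest: le_degree)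
      qed
      show "\<forall>i\<in>{..n} - pair_support (int p) w. X (int i + s) (x (int i + s)) = 1"
        using p by (auto simp: X_def pair_support_def root_char_eq_1_iff)
    qed simp
    finally show ?thesis
      unfolding cells by (subst prod.reindex) (auto simp: inj_on_def)
  qed
  ultimately show "character_factors (Zp2 p) (poly_char p s w) X"
    using finite_pair_support by (simp add: character_factors_def cells)
qed

lemma group_Zp2: "group (Zp2 p)"
  by (simp add: Zp2_def DirProd_group)

lemma config_character_poly_char: "p > 1 \<Longrightarrow> config_character (Zp2 p) (poly_char p s w)"
  by (rule config_character_of_factors[OF poly_char_factors(1)]) (simp_all add: group.is_monoid group_Zp2)

lemma character_rank_poly_char:
  assumes "p > 1"
  shows "character_rank (Zp2 p) (poly_char p s w) = card (pair_support (int p) w)"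
  unfolding character_rank_eq[OF group_Zp2 poly_char_factors(1)[OF assms]] poly_char_factors(2)[OF assms]
  by (rule card_image) (simp add: inj_on_def)


lemma config_character_integrable:
  assumes "config_character A \<xi>" "borel_probability A \<mu>"
  shows "integrable \<mu> \<xi>"
proof -
  interpret prob_space \<mu> using assms(2) by (simp add: borel_probability_def)
  have sets: "sets \<mu> = sets (config_borel A)" using assms(2) by (simp add: borel_probability_def)
  have sp: "space \<mu> = carrier (config_group A)"
    using sets_eq_imp_space_eq[OF sets] by (simp add: space_config_borel)
  have hom: "\<xi> \<in> hom (config_group A) circle_group"
    and "continuous_map (config_topology A) (top_of_set (sphere 0 1)) \<xi>"
    using assms(1) by (simp_all add: config_character_def)
  then have "\<xi> \<in> borel_measurable (config_borel A)"
    by (intro continuous_map_config_borel_measurable) (simp add: continuous_map_in_subtopology)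
  then have "\<xi> \<in> borel_measurable \<mu>" using sets by (simp cong: measurable_cong_sets)
  moreover have "cmod (\<xi> x) \<le> 1" if "x \<in> space \<mu>" for x
    using hom_in_carrier[OF hom, of x] that by (simp add: sp)
  ultimately show ?thesis by (intro integrable_const_bound[of _ 1] AE_I2)
qed

lemma continuous_map_config_measurable:
  assumes "continuous_map (config_topology A) (config_topology B) \<Phi>"
  shows "\<Phi> \<in> measurable (config_borel A) (config_borel B)"
  unfolding config_borel_def[of B]
proof (rule measurable_measure_of)
  show "{U. openin (config_topology B) U} \<subseteq> Pow (topspace (config_topology B))"
    using openin_subset by blast
  show "\<Phi> \<in> space (config_borel A) \<rightarrow> topspace (config_topology B)"
    using continuous_map_funspace[OF assms]
    by (simp add: space_config_borel topspace_config_topology carrier_config_group)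
  fix U assume "U \<in> {U. openin (config_topology B) U}"
  then have "openin (config_topology A) {x \<in> topspace (config_topology A). \<Phi> x \<in> U}"
    using assms by (intro openin_continuous_map_preimage) auto
  moreover have "\<Phi> -` U \<inter> space (config_borel A) = {x \<in> topspace (config_topology A). \<Phi> x \<in> U}"
    by (auto simp: space_config_borel topspace_config_topology carrier_config_group)
  ultimately show "\<Phi> -` U \<inter> space (config_borel A) \<in> sets (config_borel A)"
    by (simp add: openin_sets_config_borel)
qed

lemma continuous_map_funpow:
  "continuous_map T T \<Phi> \<Longrightarrow> continuous_map T T (\<Phi> ^^ t)"
  by (induction t) (auto simp: continuous_map_compose id_def[symmetric])

lemma borel_probability_distr_funpow:
  assumes "continuous_map (config_topology A) (config_topology A) \<Phi>" "borel_probability A \<mu>"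
  shows "borel_probability A (distr \<mu> (config_borel A) (\<Phi> ^^ t))"
    and "\<Phi> ^^ t \<in> measurable \<mu> (config_borel A)"
proof -
  have "\<Phi> ^^ t \<in> measurable (config_borel A) (config_borel A)"
    using assms(1) by (intro continuous_map_config_measurable continuous_map_funpow)
  then show "\<Phi> ^^ t \<in> measurable \<mu> (config_borel A)"
    using assms(2) by (simp add: borel_probability_def cong: measurable_cong_sets)
  then show "borel_probability A (distr \<mu> (config_borel A) (\<Phi> ^^ t))"
    using assms(2) by (simp add: borel_probability_def prob_space.prob_space_distr)
qed

lemma poly_char_trivial:
  assumes "p > 1" "pair_support (int p) w = {}" "c \<in> carrier (config_group (Zp2 p))"
  shows "poly_char p s w c = 1"
  using assms(3) poly_char_factors[OF assms(1), where w = w and s = s] assms(2) by (simp add: character_factors_def)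

section \<open>Convergence to the Bernoulli measure\<close>

text \<open>Here dynamics meets mixing: integrating against the \<open>t\<close>-th image puts
  \<open>t\<close> dual steps on \<open>w\<close>, and the rank of the resulting characters tends to
  infinity unless \<open>w\<close> is zero modulo \<open>p\<close>.\<close>

lemma poly_char_integral_tendsto:
  assumes p: "prime p" and mix: "harmonically_mixing (Zp2 p) \<mu>"
    and cont: "continuous_map (config_topology (Zp2 p)) (config_topology (Zp2 p)) \<Phi>"
    and step: "\<And>w c. poly_char p s w (\<Phi> c) = poly_char p s (dual_step [:a, 1:] w) c"
  shows "(\<lambda>t. \<integral>c. poly_char p s w c \<partial>distr \<mu> (config_borel (Zp2 p)) (\<Phi> ^^ t)) \<longlonglongrightarrow>
    (if pair_support (int p) w = {} then 1 else 0)"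
proof -
  let ?A = "Zp2 p"
  have p1: "p > 1" using p by (rule prime_gt_1_nat)
  have \<mu>: "borel_probability ?A \<mu>" using mix by (simp add: harmonically_mixing_def)
  note distr = borel_probability_distr_funpow[OF cont \<mu>]
  note char = config_character_poly_char[OF p1]
  \<comment> \<open>The outermost \<open>\<Phi>\<close> is removed first and replaces
    \<open>w\<close> by its dual step, so \<open>w\<close> has to vary in the induction.\<close>
  have iter: "poly_char p s w ((\<Phi> ^^ t) c) = poly_char p s ((dual_step [:a, 1:] ^^ t) w) c" for t c
    by (induction t arbitrary: w) (simp_all add: step funpow_swap1[of "dual_step [:a, 1:]"])
  show ?thesis
  proof (cases "pair_support (int p) w = {}")
    case True
    have "(\<integral>c. poly_char p s w c \<partial>M) = 1" if "borel_probability ?A M" for M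
    proof -
      interpret prob_space M using that by (simp add: borel_probability_def)
      have "space M = carrier (config_group ?A)"
        using that sets_eq_imp_space_eq[of M "config_borel ?A"]
        by (simp add: borel_probability_def space_config_borel)
      then have "(\<integral>c. poly_char p s w c \<partial>M) = (\<integral>c. 1 \<partial>M)"
        by (intro Bochner_Integration.integral_cong refl) (simp add: poly_char_trivial[OF p1 True])
      then show ?thesis by (simp add: prob_space)
    qed
    then show ?thesis using distr(1) True by simp
  next
    case False
    have "(\<lambda>t. \<integral>c. poly_char p s ((dual_step [:a, 1:] ^^ t) w) c \<partial>\<mu>) \<longlonglongrightarrow> 0"
    proof (rule tendstoI)
      fix \<epsilon> :: real assume "\<epsilon> > 0"
      then obtain R where R: "\<And>\<xi>. config_character ?A \<xi> \<Longrightarrow> real (character_rank ?A \<xi>) > R \<Longrightarrow> cmod (\<integral>x. \<xi> x \<partial>\<mu>) < \<epsilon>"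
        using mix by (auto simp: harmonically_mixing_def)
      have "\<forall>\<^sub>F t in sequentially. Suc (nat \<lceil>R\<rceil>) \<le> card (pair_support (int p) ((dual_step [:a, 1:] ^^ t) w))"
        using card_pair_support_tendsto[of "int p" w a] p False by (simp add: filterlim_at_top)
      then show "\<forall>\<^sub>F t in sequentially. dist (\<integral>c. poly_char p s ((dual_step [:a, 1:] ^^ t) w) c \<partial>\<mu>) 0 < \<epsilon>"
      proof eventually_elim
        case (elim t)
        then have "R < real (card (pair_support (int p) ((dual_step [:a, 1:] ^^ t) w)))" by linarith
        then show ?case using R[OF char] by (simp add: character_rank_poly_char[OF p1])
      qed
    qed
    moreover have "(\<integral>c. poly_char p s w c \<partial>distr \<mu> (config_borel ?A) (\<Phi> ^^ t)) =
        (\<integral>c. poly_char p s ((dual_step [:a, 1:] ^^ t) w) c \<partial>\<mu>)" for t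
    proof -
      have "poly_char p s w \<in> borel_measurable (distr \<mu> (config_borel ?A) (\<Phi> ^^ t))"
        using config_character_integrable[OF char distr(1)] by (rule borel_measurable_integrable)
      then show ?thesis
        by (subst integral_distr[OF distr(2)]) (simp_all add: iter)
    qed
    ultimately show ?thesis using False by simp
  qed
qed

section \<open>Fourier inversion on cylinders\<close>

text \<open>Fourier inversion on the alphabet: the double sum is a product of two orthogonality
  sums, one for each coordinate of \<open>b - a\<close>.\<close>

lemma cell_indicator_expansion:
  assumes p: "p > 0" and a: "a \<in> carrier (Zp2 p)" and b: "b \<in> carrier (Zp2 p)"
  shows "(if b = a then 1 else 0) =
    (\<Sum>m<p. \<Sum>l<p. root_char p (- (int m * fst a + int l * snd a)) / of_nat p ^ 2 *
      root_char p (int m * fst b + int l * snd b))"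
proof -
  have eq: "int p dvd y - x \<longleftrightarrow> y = x" if "x \<in> {0..<int p}" "y \<in> {0..<int p}" for x y
    using that by (auto simp flip: mod_eq_dvd_iff)
  have "(\<Sum>m<p. \<Sum>l<p. root_char p (- (int m * fst a + int l * snd a)) / of_nat p ^ 2 *
      root_char p (int m * fst b + int l * snd b)) =
    (\<Sum>m<p. \<Sum>l<p. root_char p (int m * (fst b - fst a)) * root_char p (int l * (snd b - snd a))) / of_nat p ^ 2"
    unfolding sum_divide_distrib
    by (intro sum.cong refl) (simp add: algebra_simps flip: root_char_add)
  also have "\<dots> = (\<Sum>m<p. root_char p (int m * (fst b - fst a))) * (\<Sum>l<p. root_char p (int l * (snd b - snd a))) / of_nat p ^ 2"
    by (simp add: sum_product)
  also have "\<dots> = (if b = a then 1 else 0)"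
  proof -
    have "int p dvd fst b - fst a \<longleftrightarrow> fst b = fst a" "int p dvd snd b - snd a \<longleftrightarrow> snd b = snd a"
      using a b p by (auto intro!: eq simp: carrier_Zp2)
    then show ?thesis using p by (simp add: sum_root_char prod_eq_iff power2_eq_square)
  qed
  finally show ?thesis by simp
qed

text \<open>Fourier inversion on one cell at a time. Since the added frequencies \<open>m\<close>, \<open>l\<close> sit on a cell
  where \<open>w\<close> vanishes, only the term \<open>m = l = 0\<close> can contribute a trivial character, so that the limit
  is obtained without integrating against the Bernoulli measure.\<close>

lemma poly_char_cylinder_tendsto:
  assumes p: "p > 1" and M: "\<And>t. borel_probability (Zp2 p) (M t)"
    and lim: "\<And>w. (\<lambda>t. \<integral>c. poly_char p s w c \<partial>M t) \<longlonglongrightarrow> (if pair_support (int p) w = {} then 1 else 0)"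
    and y: "y \<in> carrier (config_group (Zp2 p))"
    and w: "pair_support (int p) w \<inter> {..<n} = {}"
  shows "(\<lambda>t. \<integral>c. poly_char p s w c * indicator (cylinder (Zp2 p) {s..<s + int n} y) c \<partial>M t)
    \<longlonglongrightarrow> (if pair_support (int p) w = {} then 1 / of_nat p ^ (2 * n) else 0)"
  using w
\<comment> \<open>Expanding the indicator of the last cell of the window multiplies the character by
  new ones, so the hypothesis is needed for other pairs than \<open>w\<close>.\<close>
proof (induction n arbitrary: w)
  case 0
  have "(\<integral>c. poly_char p s w c * indicator (cylinder (Zp2 p) {s..<s + int 0} y) c \<partial>M t) = (\<integral>c. poly_char p s w c \<partial>M t)" for t
  proof (rule Bochner_Integration.integral_cong)
    fix c assume "c \<in> space (M t)"
    then have "c \<in> carrier (config_group (Zp2 p))"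
      using M[of t] sets_eq_imp_space_eq[of "M t" "config_borel (Zp2 p)"]
      by (simp add: borel_probability_def space_config_borel)
    then show "poly_char p s w c * indicator (cylinder (Zp2 p) {s..<s + int 0} y) c = poly_char p s w c"
      by (simp add: cylinder_def)
  qed simp
  then show ?case using lim[of w] by (cases "pair_support (int p) w = {}") simp_all
next
  case (Suc n)
  let ?A = "Zp2 p"
  define C where "C k = cylinder ?A {s..<s + int k} y" for k
  define a where "a = y (s + int n)"
  define K where "K m l = root_char p (- (int m * fst a + int l * snd a)) / of_nat p ^ 2" for m l :: nat
  \<comment> \<open>The character at cell \<open>s + int n\<close> with frequencies \<open>m\<close>
    and \<open>l\<close> corresponds to adding monomials of degree \<open>n\<close> to the
    pair.\<close>
  define W where "W m l = (fst w + monom (int m) n, snd w + monom (int l) n)" for m l :: nat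
  have p0: "p > 0" using p by simp
  have cell: "x k \<in> carrier ?A" if "x \<in> carrier (config_group ?A)" for x k
    using that by (auto simp: carrier_config_group)
  have expand: "poly_char p s w c * indicator (C (Suc n)) c =
      (\<Sum>m<p. \<Sum>l<p. K m l * (poly_char p s (W m l) c * indicator (C n) c))"
    if c: "c \<in> carrier (config_group ?A)" for c
  proof -
    have "{s..<s + int (Suc n)} = insert (s + int n) {s..<s + int n}" by auto
    then have "indicator (C (Suc n)) c = (if c (s + int n) = a then 1 else 0) * (indicator (C n) c :: complex)"
      by (auto simp: C_def cylinder_def a_def indicator_def)
    also have "(if c (s + int n) = a then 1 else 0) = (\<Sum>m<p. \<Sum>l<p. K m l *
        root_char p (int m * fst (c (s + int n)) + int l * snd (c (s + int n))))"
      unfolding K_def using y c by (intro cell_indicator_expansion p0) (auto simp: a_def cell)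
    finally have "poly_char p s w c * indicator (C (Suc n)) c = (\<Sum>m<p. \<Sum>l<p.
        poly_char p s w c * (K m l * root_char p (int m * fst (c (s + int n)) + int l * snd (c (s + int n))) * indicator (C n) c))"
      by (simp only: sum_distrib_right sum_distrib_left)
    moreover have "poly_char p s (W m l) c =
        poly_char p s w c * root_char p (int m * fst (c (s + int n)) + int l * snd (c (s + int n)))" for m l
      using poly_char_add[of p s "fst w" "monom (int m) n" "snd w" "monom (int l) n" c]
      by (simp add: W_def poly_char_def[of p s "(monom _ _, _)"] add.commute)
    ultimately show ?thesis by (simp add: mult_ac)
  qed
  have int: "integrable (M t) (\<lambda>c. poly_char p s v c * indicator (C k) c)" for t v k
  proof (rule Bochner_Integration.integrable_bound)
    have "C k \<in> sets (config_borel ?A)" unfolding C_def using y by (intro cylinder_sets) (auto simp: cell)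
    then have [measurable]: "C k \<in> sets (M t)" using M by (simp add: borel_probability_def)
    show I: "integrable (M t) (poly_char p s v)"
      using config_character_integrable[OF config_character_poly_char[OF p] M] .
    have [measurable]: "poly_char p s v \<in> borel_measurable (M t)" using I by simp
    show "(\<lambda>c. poly_char p s v c * indicator (C k) c) \<in> borel_measurable (M t)" by measurable
  qed (auto simp: indicator_def norm_mult)
  have integral: "(\<integral>c. poly_char p s w c * indicator (C (Suc n)) c \<partial>M t) =
      (\<Sum>m<p. \<Sum>l<p. K m l * (\<integral>c. poly_char p s (W m l) c * indicator (C n) c \<partial>M t))" for t
  proof -
    have "space (M t) = carrier (config_group ?A)"
      using M[of t] sets_eq_imp_space_eq[of "M t" "config_borel ?A"]
      by (simp add: borel_probability_def space_config_borel)
    then have "(\<integral>c. poly_char p s w c * indicator (C (Suc n)) c \<partial>M t) =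
        (\<integral>c. (\<Sum>m<p. \<Sum>l<p. K m l * (poly_char p s (W m l) c * indicator (C n) c)) \<partial>M t)"
      by (intro Bochner_Integration.integral_cong refl) (simp add: expand)
    also have "\<dots> = (\<Sum>m<p. \<Sum>l<p. K m l * (\<integral>c. poly_char p s (W m l) c * indicator (C n) c \<partial>M t))"
      using int by (simp add: Bochner_Integration.integral_sum)
    finally show ?thesis .
  qed
  have n: "n \<notin> pair_support (int p) w" using Suc.prems by auto
  have W_off: "i \<in> pair_support (int p) (W m l) \<longleftrightarrow> i \<in> pair_support (int p) w" if "i \<noteq> n" for i m l
    using that by (simp add: pair_support_def W_def)
  \<comment> \<open>Since \<open>w\<close> vanishes modulo \<open>p\<close> at index
    \<open>n\<close>, nothing can cancel frequencies below \<open>p\<close> unless both are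
    0.\<close>
  have W_on: "n \<in> pair_support (int p) (W m l) \<longleftrightarrow> \<not> (m = 0 \<and> l = 0)" if "m < p" "l < p" for m l
  proof -
    have "int p dvd int j \<longleftrightarrow> j = 0" if "j < p" for j
      using that by (auto simp: dvd_imp_le not_le intro: ccontr dest: dvd_imp_le)
    then show ?thesis using n that by (auto simp: pair_support_def W_def dvd_add_right_iff)
  qed
  have W_supp: "pair_support (int p) (W m l) \<inter> {..<n} = {}" for m l
  proof -
    have "i \<notin> pair_support (int p) (W m l)" if "i < n" for i
      using that Suc.prems W_off[of i m l] by auto
    then show ?thesis by blast
  qed
  have W_empty: "pair_support (int p) (W m l) = {} \<longleftrightarrow> pair_support (int p) w = {} \<and> m = 0 \<and> l = 0"
    if "m < p" "l < p" for m l
    using n W_on[OF that] W_off[of _ m l] by (metis (no_types, opaque_lifting) all_not_in_conv)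
  have "(\<lambda>t. \<integral>c. poly_char p s w c * indicator (C (Suc n)) c \<partial>M t) \<longlonglongrightarrow>
      (\<Sum>m<p. \<Sum>l<p. K m l * (if pair_support (int p) (W m l) = {} then 1 / of_nat p ^ (2 * n) else 0))"
    unfolding integral unfolding C_def by (intro tendsto_sum tendsto_mult tendsto_const Suc.IH W_supp)
  also have "(\<Sum>m<p. \<Sum>l<p. K m l * (if pair_support (int p) (W m l) = {} then 1 / of_nat p ^ (2 * n) else 0)) =
      (\<Sum>m<p. \<Sum>l<p. if l = 0 then if m = 0 then K 0 0 * (if pair_support (int p) w = {} then 1 / of_nat p ^ (2 * n) else 0) else 0 else 0)"
    by (intro sum.cong refl) (auto simp: W_empty)
  \<comment> \<open>The surviving coefficient \<open>K 0 0\<close> is 1 over \<open>p ^ 2\<close>,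
    which accounts for one more cell in the exponent.\<close>
  also have "\<dots> = (if pair_support (int p) w = {} then 1 / of_nat p ^ (2 * Suc n) else 0)"
    using p0 by (simp add: sum.delta K_def power2_eq_square)
  finally show ?case unfolding C_def .
qed

section \<open>Comparison with the Bernoulli measure\<close>

lemma measure_uniform_bernoulli_cylinder:
  assumes fin: "finite (carrier A)" "finite S" and y: "y \<in> carrier (config_group A)"
  shows "measure (uniform_bernoulli A) (cylinder A S y) = 1 / real (card (carrier A)) ^ card S"
proof -
  have yk: "y k \<in> carrier A" for k using y by (auto simp: carrier_config_group)
  interpret U: prob_space "uniform_count_measure (carrier A)"
    using fin yk[of 0] by (intro prob_space_uniform_count_measure) auto
  interpret product_prob_space "\<lambda>_::int. uniform_count_measure (carrier A)" UNIV
    by unfold_locales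
  have "cylinder A S y = {x \<in> space (uniform_bernoulli A). \<forall>k\<in>S. x k \<in> {y k}}"
    by (auto simp: cylinder_def uniform_bernoulli_def space_PiM space_uniform_count_measure carrier_config_group)
  then have "emeasure (uniform_bernoulli A) (cylinder A S y) = (\<Prod>k\<in>S. emeasure (uniform_count_measure (carrier A)) {y k})"
    unfolding uniform_bernoulli_def using fin yk
    by (simp only:) (rule emeasure_PiM_Collect, auto simp: sets_uniform_count_measure)
  also have "\<dots> = (\<Prod>k\<in>S. ennreal (1 / real (card (carrier A))))"
    using fin yk by (intro prod.cong refl) (simp add: U.emeasure_eq_measure measure_uniform_count_measure)
  also have "\<dots> = ennreal (1 / real (card (carrier A)) ^ card S)"
    by (simp add: ennreal_power power_one_over)
  finally show ?thesis by (simp add: measure_def)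
qed

text \<open>Cylinders over symmetric windows suffice for weak-star convergence. On them, the limit
  found by Fourier inversion agrees with the Bernoulli value because the alphabet has
  \<open>p ^ 2\<close> letters.\<close>

lemma strongly_randomizes_of_dual_step:
  assumes p: "prime p"
    and cont: "continuous_map (config_topology (Zp2 p)) (config_topology (Zp2 p)) \<Phi>"
    and step: "\<And>s w c. poly_char p s w (\<Phi> c) = poly_char p s (dual_step [:a, 1:] w) c"
  shows "strongly_randomizes_harmonically_mixing (Zp2 p) \<Phi>"
  unfolding strongly_randomizes_harmonically_mixing_def
proof (intro allI impI)
  fix \<mu> assume mix: "harmonically_mixing (Zp2 p) \<mu>"
  let ?A = "Zp2 p" and ?M = "\<lambda>t. distr \<mu> (config_borel (Zp2 p)) (\<Phi> ^^ t)"
  have p1: "p > 1" and p0: "p > 0" using p prime_gt_1_nat[of p] by auto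
  have fin: "finite (carrier ?A)" and card: "card (carrier ?A) = p ^ 2"
    using p0 by (simp_all add: carrier_Zp2 card_cartesian_product power2_eq_square)
  have M: "borel_probability ?A (?M t)" for t
    using mix by (intro borel_probability_distr_funpow cont) (simp add: harmonically_mixing_def)
  show "weak_star_tendsto ?A ?M (uniform_bernoulli ?A)"
  proof (rule weak_star_tendsto_cylinders[OF fin])
    show "prob_space (?M t)" "sets (?M t) = sets (config_borel ?A)" for t
      using M[of t] by (simp_all add: borel_probability_def)
    show "prob_space (uniform_bernoulli ?A)" "sets (uniform_bernoulli ?A) = sets (config_borel ?A)"
      using prob_space_uniform_bernoulli[OF group_Zp2 fin] sets_uniform_bernoulli[OF fin] .
    fix n :: nat and y assume y: "y \<in> carrier (config_group ?A)"
    let ?C = "cylinder ?A {- int n..int n} y" and ?k = "2 * n + 1"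
    \<comment> \<open>A half-open window starting at \<open>s = - int n\<close>, so that its first
      cell corresponds to coefficient index 0.\<close>
    have win: "{- int n..int n} = {- int n..<- int n + int ?k}" by auto
    \<comment> \<open>The zero pair is the constant character 1, so these integrals are the cylinder
      probabilities themselves.\<close>
    have "(\<lambda>t. \<integral>c. poly_char p (- int n) (0, 0) c * indicator ?C c \<partial>?M t) \<longlonglongrightarrow>
        (if pair_support (int p) (0, 0) = {} then 1 / of_nat p ^ (2 * ?k) else 0)"
      unfolding win
      by (rule poly_char_cylinder_tendsto[OF p1 M poly_char_integral_tendsto[OF p mix cont step] y])
         (simp add: pair_support_def)
    moreover have "(\<integral>c. poly_char p (- int n) (0, 0) c * indicator ?C c \<partial>?M t) = of_real (measure (?M t) ?C)" for t
    proof -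
      interpret prob_space "?M t" using M by (simp add: borel_probability_def)
      have "?C \<in> sets (config_borel ?A)"
        using y by (intro cylinder_sets) (auto simp: carrier_config_group)
      moreover have "(\<integral>c. indicator ?C c \<partial>?M t) = (\<integral>c. complex_of_real (indicator ?C c) \<partial>?M t)"
        by (intro Bochner_Integration.integral_cong refl) (simp add: indicator_def)
      moreover have "?C \<inter> carrier (config_group ?A) = ?C" by (auto simp: cylinder_def)
      ultimately have "(\<integral>c. indicator ?C c \<partial>?M t) = complex_of_real (measure (?M t) ?C)"
        by (simp add: integral_complex_of_real space_config_borel)
      then show ?thesis by (simp add: poly_char_def coeff_pairing_def)
    qed
    ultimately have "(\<lambda>t. of_real (measure (?M t) ?C) :: complex) \<longlonglongrightarrow> of_real (1 / real p ^ (2 * ?k))"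
      by (simp add: pair_support_def)
    then have "(\<lambda>t. measure (?M t) ?C) \<longlonglongrightarrow> 1 / real p ^ (2 * ?k)"
      by (simp only: tendsto_of_real_iff)
    moreover have "measure (uniform_bernoulli ?A) ?C = 1 / real p ^ (2 * ?k)"
    proof -
      have "card {- int n..int n} = ?k" by simp
      then show ?thesis
        using measure_uniform_bernoulli_cylinder[OF fin finite_atLeastAtMost_int y, of "- int n" "int n"]
        by (simp only: card power_mult of_nat_power)
    qed
    ultimately show "(\<lambda>t. measure (?M t) ?C) \<longlonglongrightarrow> measure (uniform_bernoulli ?A) ?C" by simp
  qed
qed

theorem theorem4:
  fixes p :: nat
  assumes "prime p"
  shows "strongly_randomizes_harmonically_mixing (Zp2 p) (F_ca p) \<and>
         strongly_randomizes_harmonically_mixing (Zp2 p) (G_ca p)"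
proof
  have "p > 0" using assms by (rule prime_gt_0_nat)
  note ca = abelian_cellular_automaton_F_G[OF this, unfolded abelian_cellular_automaton_def]
  show "strongly_randomizes_harmonically_mixing (Zp2 p) (F_ca p)"
    using assms ca(1) poly_char_F_ca[OF \<open>p > 0\<close>] by (intro strongly_randomizes_of_dual_step) auto
  show "strongly_randomizes_harmonically_mixing (Zp2 p) (G_ca p)"
    using assms ca(2) poly_char_G_ca[OF \<open>p > 0\<close>] by (intro strongly_randomizes_of_dual_step) auto
qed

end
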